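(* Let $E$ be a directed graph with finitely many vertices and no sources. Suppose further that the relative commutant $\mathcal F_E'\cap C^*(E)$ of $\mathcal F_E$ in $C^*(E)$ is trivial, i.e. equal to $\mathbb C1$. If $u\in\mathcal U(C^*(E))$ and $u\mathcal F_Eu^*\subseteq\mathcal F_E$, then $u\in\mathcal U(\mathcal F_E)$.
   Context: A directed graph $E=(E^0,E^1,r,s)$ has countable vertex set $E^0$, countable edge set $E^1$, and range and source maps $r,s:E^1\to E^0$. $C^*(E)$ is the universal $C^*$-algebra generated by mutually orthogonal projections $P_v$ ($v\in E^0$) and partial isometries $S_e$ ($e\in E^1$) with $S_e^*S_e=P_{r(e)}$, $S_e^*S_f=0$ for $e\ne f$, $S_eS_e^*\le P_{s(e)}$, and $P_v=\sum_{s(e)=v}S_eS_e^*$ whenever $v$ emits finitely many and at least one edge. It is unital when $E^0$ is finite, with $1=\sum_{v}P_v$. A source is a vertex receiving no edges, i.e. $r^{-1}(v)=\emptyset$. $\mathcal F_E$ (the core AF-subalgebra) is the fixed-point algebra of the gauge action $\gamma:U(1)\to\mathrm{Aut}(C^*(E))$, given by $\gamma_t(S_e)=tS_e$, $\gamma_t(P_v)=P_v$. $\mathcal U(A)$ denotes the unitary group of a unital algebra $A$. *)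

theory Defs
  imports
    "HOL-Analysis.Abstract_Metric_Spaces"
    "HOL-Algebra.Bij"
    "HOL-Algebra.Module"
    "HOL-Algebra.Algebraic_Closure_Type"
    "HOL-Library.Countable_Set"
    "Graph_Theory.Digraph"
begin

section \<open>C*-algebras\<close>

text \<open>
  A C*-algebra need not be unital, so the field \<^const>\<open>one\<close> inherited from the HOL-Algebra
  record is never constrained nor used below. The multiplicative identity, where there is one,
  is \<open>cstar_unit\<close>.
\<close>

record 'a cstar = "(complex, 'a) module" +
  star :: "'a \<Rightarrow> 'a"
  cnorm :: "'a \<Rightarrow> real"

text \<open>
  The locale \<^locale>\<open>Metric_space\<close> demands symmetry and nonnegativity on the whole type, hence the
  totalisation outside the carrier.
\<close>

definition cdist :: "'a cstar \<Rightarrow> 'a \<Rightarrow> 'a \<Rightarrow> real" where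
  "cdist A x y = (if x \<in> carrier A \<and> y \<in> carrier A then cnorm A (x \<ominus>\<^bsub>A\<^esub> y) else 0)"

definition cstar_topology :: "'a cstar \<Rightarrow> 'a topology" where
  "cstar_topology A = Metric_space.mtopology (carrier A) (cdist A)"

locale cstar_algebra =
  module "ring_of_type_algebra :: complex ring" A for A :: "'a cstar" (structure) +
  assumes mult_closed: "\<lbrakk>x \<in> carrier A; y \<in> carrier A\<rbrakk> \<Longrightarrow> x \<otimes> y \<in> carrier A"
    and mult_assoc:
      "\<lbrakk>x \<in> carrier A; y \<in> carrier A; z \<in> carrier A\<rbrakk> \<Longrightarrow> (x \<otimes> y) \<otimes> z = x \<otimes> (y \<otimes> z)"
    and mult_add_left:
      "\<lbrakk>x \<in> carrier A; y \<in> carrier A; z \<in> carrier A\<rbrakk> \<Longrightarrow> (x \<oplus> y) \<otimes> z = x \<otimes> z \<oplus> y \<otimes> z"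
    and mult_add_right:
      "\<lbrakk>x \<in> carrier A; y \<in> carrier A; z \<in> carrier A\<rbrakk> \<Longrightarrow> z \<otimes> (x \<oplus> y) = z \<otimes> x \<oplus> z \<otimes> y"
    and smult_mult_left: "\<lbrakk>x \<in> carrier A; y \<in> carrier A\<rbrakk> \<Longrightarrow> (c \<odot> x) \<otimes> y = c \<odot> (x \<otimes> y)"
    and smult_mult_right: "\<lbrakk>x \<in> carrier A; y \<in> carrier A\<rbrakk> \<Longrightarrow> x \<otimes> (c \<odot> y) = c \<odot> (x \<otimes> y)"
    and star_closed: "x \<in> carrier A \<Longrightarrow> star A x \<in> carrier A"
    and star_star: "x \<in> carrier A \<Longrightarrow> star A (star A x) = x"
    and star_add:
      "\<lbrakk>x \<in> carrier A; y \<in> carrier A\<rbrakk> \<Longrightarrow> star A (x \<oplus> y) = star A x \<oplus> star A y"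
    and star_smult: "x \<in> carrier A \<Longrightarrow> star A (c \<odot> x) = cnj c \<odot> star A x"
    and star_mult:
      "\<lbrakk>x \<in> carrier A; y \<in> carrier A\<rbrakk> \<Longrightarrow> star A (x \<otimes> y) = star A y \<otimes> star A x"
    and cnorm_nonneg: "x \<in> carrier A \<Longrightarrow> cnorm A x \<ge> 0"
    and cnorm_eq_0: "x \<in> carrier A \<Longrightarrow> cnorm A x = 0 \<longleftrightarrow> x = \<zero>"
    and cnorm_triangle:
      "\<lbrakk>x \<in> carrier A; y \<in> carrier A\<rbrakk> \<Longrightarrow> cnorm A (x \<oplus> y) \<le> cnorm A x + cnorm A y"
    and cnorm_smult: "x \<in> carrier A \<Longrightarrow> cnorm A (c \<odot> x) = cmod c * cnorm A x"
    and cnorm_mult: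
      "\<lbrakk>x \<in> carrier A; y \<in> carrier A\<rbrakk> \<Longrightarrow> cnorm A (x \<otimes> y) \<le> cnorm A x * cnorm A y"
    and cstar_identity: "x \<in> carrier A \<Longrightarrow> cnorm A (star A x \<otimes> x) = (cnorm A x)\<^sup>2"
    and complete: "Metric_space.mcomplete (carrier A) (cdist A)"

definition cstar_subalgebra :: "'a set \<Rightarrow> 'a cstar \<Rightarrow> bool" where
  "cstar_subalgebra B A \<longleftrightarrow>
     B \<subseteq> carrier A \<and> \<zero>\<^bsub>A\<^esub> \<in> B \<and>
     (\<forall>x\<in>B. \<forall>y\<in>B. x \<oplus>\<^bsub>A\<^esub> y \<in> B \<and> x \<otimes>\<^bsub>A\<^esub> y \<in> B) \<and>
     (\<forall>c. \<forall>x\<in>B. c \<odot>\<^bsub>A\<^esub> x \<in> B) \<and>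
     (\<forall>x\<in>B. star A x \<in> B) \<and>
     closedin (cstar_topology A) B"

definition star_hom :: "'a cstar \<Rightarrow> 'b cstar \<Rightarrow> ('a \<Rightarrow> 'b) set" where
  "star_hom A B =
     {\<phi>. \<phi> \<in> carrier A \<rightarrow> carrier B \<and>
         (\<forall>x\<in>carrier A. \<forall>y\<in>carrier A. \<phi> (x \<oplus>\<^bsub>A\<^esub> y) = \<phi> x \<oplus>\<^bsub>B\<^esub> \<phi> y) \<and>
         (\<forall>x\<in>carrier A. \<forall>y\<in>carrier A. \<phi> (x \<otimes>\<^bsub>A\<^esub> y) = \<phi> x \<otimes>\<^bsub>B\<^esub> \<phi> y) \<and>
         (\<forall>c. \<forall>x\<in>carrier A. \<phi> (c \<odot>\<^bsub>A\<^esub> x) = c \<odot>\<^bsub>B\<^esub> \<phi> x) \<and>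
         (\<forall>x\<in>carrier A. \<phi> (star A x) = star B (\<phi> x))}"

definition star_aut :: "'a cstar \<Rightarrow> ('a \<Rightarrow> 'a) set" where
  "star_aut A = star_hom A A \<inter> Bij (carrier A)"

definition cstar_unit :: "'a cstar \<Rightarrow> 'a" where
  "cstar_unit A = (THE e. e \<in> carrier A \<and> (\<forall>x\<in>carrier A. e \<otimes>\<^bsub>A\<^esub> x = x \<and> x \<otimes>\<^bsub>A\<^esub> e = x))"

definition unitary_group :: "'a cstar \<Rightarrow> 'a set" where
  "unitary_group A =
     {u \<in> carrier A. star A u \<otimes>\<^bsub>A\<^esub> u = cstar_unit A \<and> u \<otimes>\<^bsub>A\<^esub> star A u = cstar_unit A}"

definition relative_commutant :: "'a cstar \<Rightarrow> 'a set \<Rightarrow> 'a set" where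
  "relative_commutant A B = {x \<in> carrier A. \<forall>y\<in>B. x \<otimes>\<^bsub>A\<^esub> y = y \<otimes>\<^bsub>A\<^esub> x}"

definition projection :: "'a cstar \<Rightarrow> 'a \<Rightarrow> bool" where
  "projection A p \<longleftrightarrow> p \<in> carrier A \<and> star A p = p \<and> p \<otimes>\<^bsub>A\<^esub> p = p"

definition partial_isometry :: "'a cstar \<Rightarrow> 'a \<Rightarrow> bool" where
  "partial_isometry A s \<longleftrightarrow> s \<in> carrier A \<and> s \<otimes>\<^bsub>A\<^esub> star A s \<otimes>\<^bsub>A\<^esub> s = s"

text \<open>The usual order on projections: \<open>p \<le> q\<close> iff \<open>q p = p = p q\<close>.\<close>

definition projection_le :: "'a cstar \<Rightarrow> 'a \<Rightarrow> 'a \<Rightarrow> bool" where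
  "projection_le A p q \<longleftrightarrow>
     projection A p \<and> projection A q \<and> q \<otimes>\<^bsub>A\<^esub> p = p \<and> p \<otimes>\<^bsub>A\<^esub> q = p"


section \<open>Graph C*-algebras\<close>

text \<open>The source map is \<^const>\<open>tail\<close> and the range map is \<^const>\<open>head\<close>.\<close>

locale countable_digraph = wf_digraph +
  assumes countable_verts: "countable (verts G)"
    and countable_arcs: "countable (arcs G)"

definition cuntz_krieger_family ::
    "('v, 'e) pre_digraph \<Rightarrow> 'a cstar \<Rightarrow> ('v \<Rightarrow> 'a) \<Rightarrow> ('e \<Rightarrow> 'a) \<Rightarrow> bool" where
  "cuntz_krieger_family E A P S \<longleftrightarrow>
     (\<forall>v\<in>verts E. projection A (P v)) \<and>
     (\<forall>v\<in>verts E. \<forall>w\<in>verts E. v \<noteq> w \<longrightarrow> P v \<otimes>\<^bsub>A\<^esub> P w = \<zero>\<^bsub>A\<^esub>) \<and>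
     (\<forall>e\<in>arcs E. partial_isometry A (S e)) \<and>
     (\<forall>e\<in>arcs E. star A (S e) \<otimes>\<^bsub>A\<^esub> S e = P (head E e)) \<and>
     (\<forall>e\<in>arcs E. \<forall>f\<in>arcs E. e \<noteq> f \<longrightarrow> star A (S e) \<otimes>\<^bsub>A\<^esub> S f = \<zero>\<^bsub>A\<^esub>) \<and>
     (\<forall>e\<in>arcs E. projection_le A (S e \<otimes>\<^bsub>A\<^esub> star A (S e)) (P (tail E e))) \<and>
     (\<forall>v\<in>verts E. finite (out_arcs E v) \<and> out_arcs E v \<noteq> {} \<longrightarrow>
        P v = (\<Oplus>\<^bsub>A\<^esub>e\<in>out_arcs E v. S e \<otimes>\<^bsub>A\<^esub> star A (S e)))"

text \<open>
  \<open>(A, P, S)\<close> is a model of the universal C*-algebra generated by a Cuntz--Krieger \<open>E\<close>-family.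
  HOL cannot quantify over the carrier types of the target algebras inside a formula. Since \<open>E\<close>
  is countable, the C*-subalgebra generated by any Cuntz--Krieger \<open>E\<close>-family is separable, so it
  has at most as many elements as there are reals and has an isomorphic copy with carrier in
  \<^typ>\<open>real\<close>. Targets with carrier in \<^typ>\<open>'a + real\<close> therefore suffice for the universal
  property with respect to all C*-algebras; the summand \<^typ>\<open>'a\<close> makes \<open>A\<close> itself directly
  available as a target.
\<close>

definition graph_cstar_algebra ::
    "('v, 'e) pre_digraph \<Rightarrow> 'a cstar \<Rightarrow> ('v \<Rightarrow> 'a) \<Rightarrow> ('e \<Rightarrow> 'a) \<Rightarrow> bool" where
  "graph_cstar_algebra E A P S \<longleftrightarrow>
     cstar_algebra A \<and>
     cuntz_krieger_family E A P S \<and>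
     (\<forall>B. cstar_subalgebra B A \<and> P ` verts E \<subseteq> B \<and> S ` arcs E \<subseteq> B \<longrightarrow> B = carrier A) \<and>
     (\<forall>(B :: ('a + real) cstar) Q T.
        cstar_algebra B \<and> cuntz_krieger_family E B Q T \<longrightarrow>
        (\<exists>\<phi>\<in>star_hom A B. (\<forall>v\<in>verts E. \<phi> (P v) = Q v) \<and> (\<forall>e\<in>arcs E. \<phi> (S e) = T e)))"

text \<open>
  For \<open>|t| = 1\<close> the automorphism below exists by universality and is unique because \<open>P\<close> and \<open>S\<close>
  generate \<open>A\<close> and elements of \<^const>\<open>star_aut\<close> are extensional; other \<open>t\<close> are not used.
\<close>

definition gauge_action ::
    "('v, 'e) pre_digraph \<Rightarrow> 'a cstar \<Rightarrow> ('v \<Rightarrow> 'a) \<Rightarrow> ('e \<Rightarrow> 'a) \<Rightarrow> complex \<Rightarrow> 'a \<Rightarrow> 'a" where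
  "gauge_action E A P S t =
     (THE \<gamma>. \<gamma> \<in> star_aut A \<and> (\<forall>e\<in>arcs E. \<gamma> (S e) = t \<odot>\<^bsub>A\<^esub> S e) \<and> (\<forall>v\<in>verts E. \<gamma> (P v) = P v))"

definition core :: "('v, 'e) pre_digraph \<Rightarrow> 'a cstar \<Rightarrow> ('v \<Rightarrow> 'a) \<Rightarrow> ('e \<Rightarrow> 'a) \<Rightarrow> 'a set" where
  "core E A P S = {x \<in> carrier A. \<forall>t. cmod t = 1 \<longrightarrow> gauge_action E A P S t x = x}"

end

theory Submission
  imports Defs "HOL-Analysis.Urysohn"
begin

text \<open>
  Why the theorem holds. Let \<open>\<gamma>\<close> be the gauge action and \<open>F\<close> its fixed-point algebra. For \<open>x\<close> in \<open>F\<close> both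
  \<open>x\<close> and \<open>u x u\<^sup>*\<close> are gauge invariant, so \<open>u\<^sup>* \<gamma>\<^sub>t(u)\<close> commutes with \<open>F\<close> and is a scalar. Thus \<open>u\<close> is a
  common eigenvector of the gauge automorphisms, and discrete Fourier coefficients show that it is
  approximated by linear combinations of monomials \<open>S\<^sub>\<mu> S\<^sub>\<nu>\<^sup>*\<close> of one fixed degree
  \<open>k = |\<mu>| - |\<nu>|\<close> (\<open>gauge_eigenvector_near_homogeneous\<close>). It remains to exclude \<open>k \<noteq> 0\<close>, and by passing to
  \<open>u\<^sup>*\<close> only \<open>k > 0\<close> has to be considered.

  As there are no sources, choose an edge into each vertex and let \<open>T\<close> be the sum of the corresponding
  partial isometries. This is an isometry of degree 1, so \<open>u\<^sup>* T\<^sup>k\<close> is an isometry that is approximated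
  by elements of degree 0. Such elements lie in finite-dimensional algebras, where left cancellable
  elements are invertible; hence \<open>u\<^sup>* T\<^sup>k\<close> is unitary (\<open>isometry_unitary_if_near_algebraic\<close>), and therefore
  \<open>T\<close> is unitary. But then all edges that were not chosen contribute zero, \<open>T\<close> permutes the vertex
  projections, and some power \<open>T\<^sup>m\<close> with \<open>m > 0\<close> is central (\<open>T_pow_central_if_T_unitary\<close>). By triviality
  of the relative commutant it is a scalar, which is fixed by \<open>\<gamma>\<close> although \<open>T\<^sup>m\<close> has degree \<open>m\<close>. This
  is impossible unless the algebra is zero.

  The analytic basis is that unital *-homomorphisms are contractive
  (\<open>unital_star_hom_contractive\<close>): it yields existence and uniqueness of the gauge automorphisms from
  universality, and lets estimates pass through them. It is proved by writing a self-adjoint element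
  of norm less than 1 as the real part of a unitary.
\<close>

section \<open>Linear and metric structure of a C*-algebra\<close>

context cstar_algebra
begin

lemma smult_closed' [simp, intro]: "x \<in> carrier A \<Longrightarrow> c \<odot> x \<in> carrier A"
  using smult_closed[of c x] by (simp add: ring_of_type_algebra_def)

lemma smult_add_left: "x \<in> carrier A \<Longrightarrow> (a + b) \<odot> x = a \<odot> x \<oplus> b \<odot> x"
  using smult_l_distr[of a b x] by (simp add: ring_of_type_algebra_def)

lemma smult_add_right: "\<lbrakk>x \<in> carrier A; y \<in> carrier A\<rbrakk> \<Longrightarrow> a \<odot> (x \<oplus> y) = a \<odot> x \<oplus> a \<odot> y"
  using smult_r_distr[of a x y] by (simp add: ring_of_type_algebra_def)

lemma smult_smult: "x \<in> carrier A \<Longrightarrow> a \<odot> (b \<odot> x) = (a * b) \<odot> x"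
  using smult_assoc1[of a b x] by (simp add: ring_of_type_algebra_def)

lemma one_smult [simp]: "x \<in> carrier A \<Longrightarrow> 1 \<odot> x = x"
  using smult_one[of x] by (simp add: ring_of_type_algebra_def)

lemma zero_smult [simp]: "x \<in> carrier A \<Longrightarrow> 0 \<odot> x = \<zero>"
  using smult_l_null[of x] by (simp add: ring_of_type_algebra_def)

lemma smult_zero [simp]: "c \<odot> \<zero> = \<zero>"
  using smult_r_null[of c] by (simp add: ring_of_type_algebra_def)

declare mult_closed [simp, intro] star_closed [simp, intro] star_star [simp]

lemma minus_smult: "x \<in> carrier A \<Longrightarrow> \<ominus> x = (-1) \<odot> x"
  by (rule M.minus_equality) (use smult_add_left[of x "-1" 1] in auto)

lemma zero_mult [simp]: "x \<in> carrier A \<Longrightarrow> \<zero> \<otimes> x = \<zero>"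
  using smult_mult_left[of x x 0] by simp

lemma mult_zero [simp]: "x \<in> carrier A \<Longrightarrow> x \<otimes> \<zero> = \<zero>"
  using smult_mult_right[of x x 0] by simp

lemma mult_minus_right:
  "\<lbrakk>x \<in> carrier A; y \<in> carrier A; z \<in> carrier A\<rbrakk> \<Longrightarrow> z \<otimes> (x \<ominus> y) = z \<otimes> x \<ominus> z \<otimes> y"
  by (simp add: a_minus_def minus_smult mult_add_right smult_mult_right)

lemma mult_minus_left:
  "\<lbrakk>x \<in> carrier A; y \<in> carrier A; z \<in> carrier A\<rbrakk> \<Longrightarrow> (x \<ominus> y) \<otimes> z = x \<otimes> z \<ominus> y \<otimes> z"
  by (simp add: a_minus_def minus_smult mult_add_left smult_mult_left)

lemma smult_minus_right:
  "\<lbrakk>x \<in> carrier A; y \<in> carrier A\<rbrakk> \<Longrightarrow> c \<odot> (x \<ominus> y) = c \<odot> x \<ominus> c \<odot> y"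
  by (simp add: a_minus_def minus_smult smult_add_right smult_smult)

lemma star_zero [simp]: "star A \<zero> = \<zero>"
  using star_smult[of \<zero> 0] by simp

lemma star_minus: "\<lbrakk>x \<in> carrier A; y \<in> carrier A\<rbrakk> \<Longrightarrow> star A (x \<ominus> y) = star A x \<ominus> star A y"
  by (simp add: a_minus_def minus_smult star_add star_smult)

lemma cnorm_zero [simp]: "cnorm A \<zero> = 0"
  using cnorm_eq_0 by simp

lemma cnorm_minus_commute:
  assumes "x \<in> carrier A" "y \<in> carrier A" shows "cnorm A (x \<ominus> y) = cnorm A (y \<ominus> x)"
proof -
  have "x \<ominus> y = (-1) \<odot> (y \<ominus> x)"
    using assms by (simp add: a_minus_def minus_smult smult_add_right smult_smult M.add.m_comm)
  then show ?thesis
    using assms by (simp add: cnorm_smult)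
qed

lemma minus_eq_zero_iff:
  assumes "x \<in> carrier A" "y \<in> carrier A" shows "x \<ominus> y = \<zero> \<longleftrightarrow> x = y"
proof
  assume "x \<ominus> y = \<zero>"
  then have "(x \<ominus> y) \<oplus> y = y" using assms by simp
  then show "x = y" using assms by (simp add: a_minus_def M.add.m_assoc M.l_neg)
qed (use assms in \<open>simp add: a_minus_def M.r_neg\<close>)

lemma add_minus_cancel_mid:
  assumes "x \<in> carrier A" "y \<in> carrier A" "z \<in> carrier A"
  shows "x \<ominus> z = (x \<ominus> y) \<oplus> (y \<ominus> z)"
  using assms by (simp add: a_minus_def M.add.m_assoc M.r_neg1)

lemma cnorm_minus_triangle:
  assumes "x \<in> carrier A" "y \<in> carrier A" "z \<in> carrier A"
  shows "cnorm A (x \<ominus> z) \<le> cnorm A (x \<ominus> y) + cnorm A (y \<ominus> z)"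
  using add_minus_cancel_mid[OF assms] cnorm_triangle[of "x \<ominus> y" "y \<ominus> z"] assms by simp

lemma cnorm_star [simp]:
  assumes x: "x \<in> carrier A" shows "cnorm A (star A x) = cnorm A x"
proof -
  have le: "cnorm A y \<le> cnorm A (star A y)" if y: "y \<in> carrier A" for y
  proof (cases "cnorm A y = 0")
    case True then show ?thesis using cnorm_nonneg y by simp
  next
    case False
    have "cnorm A y * cnorm A y \<le> cnorm A (star A y) * cnorm A y"
      using cstar_identity[OF y] cnorm_mult[of "star A y" y] y by (simp add: power2_eq_square)
    then show ?thesis
      using False cnorm_nonneg[OF y] by (simp add: mult_le_cancel_right)
  qed
  show ?thesis using le[OF x] le[of "star A x"] x by simp
qed

sublocale metric: Metric_space "carrier A" "cdist A"
proof
  fix x y z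
  show "0 \<le> cdist A x y" by (simp add: cdist_def cnorm_nonneg)
  show "cdist A x y = cdist A y x" by (simp add: cdist_def cnorm_minus_commute)
  assume x: "x \<in> carrier A" and y: "y \<in> carrier A"
  show "cdist A x y = 0 \<longleftrightarrow> x = y" using x y by (simp add: cdist_def cnorm_eq_0 minus_eq_zero_iff)
  assume z: "z \<in> carrier A"
  show "cdist A x z \<le> cdist A x y + cdist A y z"
    using x y z by (simp add: cdist_def cnorm_minus_triangle)
qed

lemma closedinI:
  assumes "B \<subseteq> carrier A"
    and "\<And>x. \<lbrakk>x \<in> carrier A; \<And>\<epsilon>. \<epsilon> > 0 \<Longrightarrow> \<exists>p\<in>B. cnorm A (x \<ominus> p) < \<epsilon>\<rbrakk> \<Longrightarrow> x \<in> B"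
  shows "closedin (cstar_topology A) B"
  unfolding cstar_topology_def metric.closedin_metric
proof (intro conjI allI impI assms(1))
  fix x assume x: "x \<in> carrier A - B"
  with assms(2)[of x] obtain \<epsilon> where \<epsilon>: "\<epsilon> > 0" "\<And>p. p \<in> B \<Longrightarrow> \<not> cnorm A (x \<ominus> p) < \<epsilon>"
    by blast
  have "disjnt B (metric.mball x \<epsilon>)"
    using \<epsilon>(2) by (auto simp: disjnt_def metric.mball_def cdist_def)
  then show "\<exists>r>0. disjnt B (metric.mball x r)" using \<epsilon>(1) by blast
qed

lemma eq_if_arbitrarily_close:
  assumes "x \<in> carrier A" "y \<in> carrier A" "K \<ge> 0"
    and "\<And>\<epsilon>. \<epsilon> > 0 \<Longrightarrow> cnorm A (x \<ominus> y) \<le> K * \<epsilon>"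
  shows "x = y"
proof (rule ccontr)
  assume "x \<noteq> y"
  then have pos: "cnorm A (x \<ominus> y) > 0"
    using assms(1,2) cnorm_nonneg[of "x \<ominus> y"] cnorm_eq_0[of "x \<ominus> y"] \<open>x \<noteq> y\<close>
    by (simp add: less_le minus_eq_zero_iff)
  have "cnorm A (x \<ominus> y) \<le> K * (cnorm A (x \<ominus> y) / (K + 1))"
    using assms(3) pos by (intro assms(4)) simp
  then show False using pos assms(3) by (simp add: field_simps)
qed

text \<open>Equations between Lipschitz maps survive norm limits; this makes the commutants, equalisers and
fixed-point sets below closed.\<close>

lemma lipschitz_eq_limit:
  assumes x: "x \<in> carrier A"
    and close: "\<And>\<epsilon>. \<epsilon> > 0 \<Longrightarrow> \<exists>p\<in>carrier A. cnorm A (x \<ominus> p) < \<epsilon> \<and> L p = R p"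
    and L: "L \<in> carrier A \<rightarrow> carrier A" and R: "R \<in> carrier A \<rightarrow> carrier A"
    and Lk: "\<And>y. y \<in> carrier A \<Longrightarrow> cnorm A (L x \<ominus> L y) \<le> k * cnorm A (x \<ominus> y)"
    and Rk: "\<And>y. y \<in> carrier A \<Longrightarrow> cnorm A (R x \<ominus> R y) \<le> l * cnorm A (x \<ominus> y)"
    and "k \<ge> 0" "l \<ge> 0"
  shows "L x = R x"
proof (rule eq_if_arbitrarily_close)
  show "L x \<in> carrier A" "R x \<in> carrier A" "k + l \<ge> 0" using assms by auto
  fix \<epsilon> :: real assume "\<epsilon> > 0"
  then obtain p where p: "p \<in> carrier A" "cnorm A (x \<ominus> p) < \<epsilon>" "L p = R p"
    using close by blast
  have "cnorm A (L x \<ominus> R x) \<le> cnorm A (L x \<ominus> L p) + cnorm A (R x \<ominus> R p)"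
    using cnorm_minus_triangle[of "L x" "L p" "R x"] cnorm_minus_commute[of "R x" "R p"] L R x p
    by (auto simp: Pi_iff)
  also have "\<dots> \<le> (k + l) * cnorm A (x \<ominus> p)"
    using Lk[OF p(1)] Rk[OF p(1)] by (simp add: algebra_simps)
  also have "\<dots> \<le> (k + l) * \<epsilon>"
    using p(2) assms(7,8) by (intro mult_left_mono) auto
  finally show "cnorm A (L x \<ominus> R x) \<le> (k + l) * \<epsilon>" .
qed

lemma finsum_mult_left:
  assumes "finite I" "f \<in> I \<rightarrow> carrier A" "x \<in> carrier A"
  shows "finsum A f I \<otimes> x = (\<Oplus>i\<in>I. f i \<otimes> x)"
  using assms
proof (induction I rule: finite_induct)
  case (insert i I)
  then have "f \<in> I \<rightarrow> carrier A" "f i \<in> carrier A" by auto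
  moreover have "(\<lambda>j. f j \<otimes> x) \<in> I \<rightarrow> carrier A" using calculation insert by auto
  ultimately show ?case using insert by (simp add: mult_add_left)
qed simp

lemma finsum_mult_right:
  assumes "finite I" "f \<in> I \<rightarrow> carrier A" "x \<in> carrier A"
  shows "x \<otimes> finsum A f I = (\<Oplus>i\<in>I. x \<otimes> f i)"
  using assms
proof (induction I rule: finite_induct)
  case (insert i I)
  then have "f \<in> I \<rightarrow> carrier A" "f i \<in> carrier A" by auto
  moreover have "(\<lambda>j. x \<otimes> f j) \<in> I \<rightarrow> carrier A" using calculation insert by auto
  ultimately show ?case using insert by (simp add: mult_add_right)
qed simp

lemma finsum_smult:
  assumes "finite I" "f \<in> I \<rightarrow> carrier A"
  shows "c \<odot> finsum A f I = (\<Oplus>i\<in>I. c \<odot> f i)"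
  using assms
proof (induction I rule: finite_induct)
  case (insert i I)
  then have "f \<in> I \<rightarrow> carrier A" "f i \<in> carrier A" by auto
  moreover have "(\<lambda>j. c \<odot> f j) \<in> I \<rightarrow> carrier A" using calculation by auto
  ultimately show ?case using insert by (simp add: smult_add_right)
qed simp

lemma finsum_smult_const:
  assumes "finite I" "x \<in> carrier A"
  shows "(\<Oplus>i\<in>I. f i \<odot> x) = (\<Sum>i\<in>I. f i) \<odot> x"
  using assms
proof (induction I rule: finite_induct)
  case (insert i I)
  then show ?case by (simp add: smult_add_left)
qed simp

lemma finsum_star:
  assumes "finite I" "f \<in> I \<rightarrow> carrier A"
  shows "star A (finsum A f I) = (\<Oplus>i\<in>I. star A (f i))"
  using assms
proof (induction I rule: finite_induct)
  case (insert i I)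
  then have "f \<in> I \<rightarrow> carrier A" "f i \<in> carrier A" by auto
  moreover have "(\<lambda>j. star A (f j)) \<in> I \<rightarrow> carrier A" using calculation by auto
  ultimately show ?case using insert by (simp add: star_add)
qed simp

lemma finsum_norm_le:
  assumes "finite I" "f \<in> I \<rightarrow> carrier A"
  shows "cnorm A (finsum A f I) \<le> (\<Sum>i\<in>I. cnorm A (f i))"
  using assms
proof (induction I rule: finite_induct)
  case (insert i I)
  then have "f \<in> I \<rightarrow> carrier A" "f i \<in> carrier A" by auto
  then show ?case using insert cnorm_triangle[of "f i" "finsum A f I"] by simp
qed simp

lemma finsum_single:
  assumes "finite I" "i \<in> I" "x \<in> carrier A" "\<And>j. \<lbrakk>j \<in> I; j \<noteq> i\<rbrakk> \<Longrightarrow> f j = \<zero>" "f i = x"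
  shows "finsum A f I = x"
proof -
  have "finsum A f I = finsum A (\<lambda>j. if i = j then x else \<zero>) I"
    using assms by (intro M.finsum_cong') auto
  also have "\<dots> = x"
    using M.finsum_singleton[OF assms(2,1), of "\<lambda>_. x"] assms(3) by simp
  finally show ?thesis .
qed

end

section \<open>Unital *-homomorphisms are contractive\<close>

locale unital_cstar_algebra = cstar_algebra +
  assumes unit_closed [simp, intro]: "\<one> \<in> carrier A"
    and unit_mult [simp]: "x \<in> carrier A \<Longrightarrow> \<one> \<otimes> x = x"
    and mult_unit [simp]: "x \<in> carrier A \<Longrightarrow> x \<otimes> \<one> = x"

sublocale unital_cstar_algebra \<subseteq> ring A
proof (rule ringI)
  show "abelian_group A" by (rule M.abelian_group_axioms)
  show "monoid A" by unfold_locales (auto simp: mult_assoc)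
qed (auto simp: mult_add_left mult_add_right)

context unital_cstar_algebra
begin

lemma cstar_unit_eq: "cstar_unit A = \<one>"
  unfolding cstar_unit_def
proof (rule the_equality)
  fix e assume "e \<in> carrier A \<and> (\<forall>x\<in>carrier A. e \<otimes> x = x \<and> x \<otimes> e = x)"
  then show "e = \<one>" using unit_mult[of e] unit_closed by metis
qed auto

lemma star_one [simp]: "star A \<one> = \<one>"
  using star_mult[of \<one> "star A \<one>"] by simp

lemma cnorm_one_le: "cnorm A \<one> \<le> 1"
proof -
  have "cnorm A \<one> * cnorm A \<one> = 1 * cnorm A \<one>"
    using cstar_identity[of \<one>] by (simp add: power2_eq_square)
  then show ?thesis using mult_right_cancel[of "cnorm A \<one>" "cnorm A \<one>" 1] by fastforce
qed

lemma isometry_cnorm_le: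
  assumes "w \<in> carrier A" "star A w \<otimes> w = \<one>" shows "cnorm A w \<le> 1"
  using cstar_identity[OF assms(1)] cnorm_one_le assms power2_le_imp_le[of "cnorm A w" 1] by simp

text \<open>The element \<open>s\<close> is \<open>(1 - h\<^sup>2)\<^sup>1\<^sup>/\<^sup>2\<close>, obtained without functional calculus: for \<open>s = 1 - y\<close> the equation
reads \<open>y = (h\<^sup>2 + y\<^sup>2) / 2\<close>, and the right-hand side is a contraction of the ball of radius
\<open>\<parallel>h\<parallel> < 1\<close>. Running the iteration inside the self-adjoint elements commuting with \<open>h\<close> passes both
properties on to \<open>s\<close>.\<close>

lemma selfadjoint_complement:
  assumes h: "h \<in> carrier A" "star A h = h" "cnorm A h < 1"
  obtains s where "s \<in> carrier A" "star A s = s" "s \<otimes> h = h \<otimes> s" "h \<otimes> h \<oplus> s \<otimes> s = \<one>"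
proof -
  define r where "r = cnorm A h"
  have r: "0 \<le> r" "r < 1" using h cnorm_nonneg by (auto simp: r_def)
  define Y where "Y = {y \<in> carrier A. star A y = y \<and> y \<otimes> h = h \<otimes> y \<and> cnorm A y \<le> r}"
  have YA: "Y \<subseteq> carrier A" by (auto simp: Y_def)
  define g where "g y = (1/2) \<odot> (h \<otimes> h \<oplus> y \<otimes> y)" for y
  have gY: "g y \<in> Y" if "y \<in> Y" for y
  proof -
    have y: "y \<in> carrier A" "star A y = y" "y \<otimes> h = h \<otimes> y" "cnorm A y \<le> r"
      using that by (auto simp: Y_def)
    have "(y \<otimes> y) \<otimes> h = h \<otimes> (y \<otimes> y)"
      using y h by (metis mult_assoc)
    then have comm: "g y \<otimes> h = h \<otimes> g y"
      using y h by (simp add: g_def smult_mult_left smult_mult_right mult_add_left mult_add_right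
          mult_assoc)
    have "cnorm A (h \<otimes> h \<oplus> y \<otimes> y) \<le> cnorm A h * cnorm A h + cnorm A y * cnorm A y"
      using cnorm_triangle[of "h \<otimes> h" "y \<otimes> y"] cnorm_mult[of h h] cnorm_mult[of y y] h y by simp
    also have "\<dots> \<le> r * r + r * r"
      using y r cnorm_nonneg[of y] by (intro add_mono mult_mono) (auto simp: r_def)
    also have "\<dots> \<le> 2 * r" using r by (simp add: mult_left_le)
    finally have "cnorm A (g y) \<le> r"
      using h y by (simp add: g_def cnorm_smult)
    then show ?thesis
      using y h comm by (simp add: Y_def g_def star_smult star_add star_mult)
  qed
  have lip: "cnorm A (g y \<ominus> g z) \<le> r * cnorm A (y \<ominus> z)" if "y \<in> Y" "z \<in> Y" for y z
  proof -
    have y: "y \<in> carrier A" "cnorm A y \<le> r" and z: "z \<in> carrier A" "cnorm A z \<le> r"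
      using that by (auto simp: Y_def)
    have "g y \<ominus> g z = (1/2) \<odot> ((h \<otimes> h \<oplus> y \<otimes> y) \<ominus> (h \<otimes> h \<oplus> z \<otimes> z))"
      using h y z by (simp add: g_def smult_minus_right)
    also have "(h \<otimes> h \<oplus> y \<otimes> y) \<ominus> (h \<otimes> h \<oplus> z \<otimes> z) = y \<otimes> (y \<ominus> z) \<oplus> (y \<ominus> z) \<otimes> z"
      using h y z by algebra
    finally have "cnorm A (g y \<ominus> g z) = cnorm A (y \<otimes> (y \<ominus> z) \<oplus> (y \<ominus> z) \<otimes> z) / 2"
      using y z by (simp add: cnorm_smult)
    also have "\<dots> \<le> (cnorm A y * cnorm A (y \<ominus> z) + cnorm A (y \<ominus> z) * cnorm A z) / 2"
      using cnorm_triangle[of "y \<otimes> (y \<ominus> z)" "(y \<ominus> z) \<otimes> z"] cnorm_mult[of y "y \<ominus> z"]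
        cnorm_mult[of "y \<ominus> z" z] y z by simp
    also have "\<dots> \<le> (r * cnorm A (y \<ominus> z) + cnorm A (y \<ominus> z) * r) / 2"
      using y z r cnorm_nonneg[of "y \<ominus> z"] cnorm_nonneg[of z]
      by (intro divide_right_mono add_mono mult_mono) auto
    finally show ?thesis by simp
  qed
  have "closedin (cstar_topology A) Y"
  proof (rule closedinI[OF YA])
    fix x assume x: "x \<in> carrier A" and close: "\<And>\<epsilon>. \<epsilon> > 0 \<Longrightarrow> \<exists>p\<in>Y. cnorm A (x \<ominus> p) < \<epsilon>"
    have 1: "star A x = x"
    proof (rule lipschitz_eq_limit[where k=1 and l=1 and L="star A" and R="\<lambda>x. x", OF x])
      show "\<exists>p\<in>carrier A. cnorm A (x \<ominus> p) < \<epsilon> \<and> star A p = p" if "\<epsilon> > 0" for \<epsilon>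
        using close[OF that] by (auto simp: Y_def)
      show "cnorm A (star A x \<ominus> star A y) \<le> 1 * cnorm A (x \<ominus> y)" if "y \<in> carrier A" for y
        using that x by (simp add: star_minus[symmetric])
    qed auto
    have 2: "x \<otimes> h = h \<otimes> x"
    proof (rule lipschitz_eq_limit[where k=r and l=r and L="\<lambda>x. x \<otimes> h" and R="\<lambda>x. h \<otimes> x", OF x])
      show "\<exists>p\<in>carrier A. cnorm A (x \<ominus> p) < \<epsilon> \<and> p \<otimes> h = h \<otimes> p" if "\<epsilon> > 0" for \<epsilon>
        using close[OF that] by (auto simp: Y_def)
      fix y assume y: "y \<in> carrier A"
      show "cnorm A (x \<otimes> h \<ominus> y \<otimes> h) \<le> r * cnorm A (x \<ominus> y)"
        using cnorm_mult[of "x \<ominus> y" h] x y h by (simp add: mult_minus_left r_def mult.commute)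
      show "cnorm A (h \<otimes> x \<ominus> h \<otimes> y) \<le> r * cnorm A (x \<ominus> y)"
        using cnorm_mult[of h "x \<ominus> y"] x y h by (simp add: mult_minus_right r_def)
    qed (use h r in auto)
    have 3: "cnorm A x \<le> r"
    proof (rule field_le_epsilon)
      fix e :: real assume "e > 0"
      then obtain p where p: "p \<in> Y" "cnorm A (x \<ominus> p) < e" using close by blast
      then have pc: "p \<in> carrier A" "cnorm A p \<le> r" by (auto simp: Y_def)
      have "x = (x \<ominus> p) \<oplus> p" using x pc by algebra
      then show "cnorm A x \<le> r + e"
        using cnorm_triangle[of "x \<ominus> p" p] x p pc by simp
    qed
    show "x \<in> Y" using x 1 2 3 by (simp add: Y_def)
  qed
  then have Ycl: "closedin metric.mtopology Y" by (simp add: cstar_topology_def)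
  interpret Y: Submetric "carrier A" "cdist A" Y
    by unfold_locales (rule YA)
  have "Y.sub.mcomplete"
    by (rule Y.closedin_mcomplete_imp_mcomplete[OF Ycl complete])
  moreover have "\<zero> \<in> Y" using h r by (simp add: Y_def)
  moreover have "g \<in> Y \<rightarrow> Y" using gY by blast
  moreover have "cdist A (g y) (g z) \<le> r * cdist A y z" if "y \<in> Y" "z \<in> Y" for y z
    using lip[OF that] gY[OF that(1)] gY[OF that(2)] that YA by (simp add: cdist_def subset_iff)
  ultimately obtain y where y: "y \<in> Y" "g y = y"
    using Y.sub.Banach_fixedpoint_thm[of g r] r by blast
  have yA: "y \<in> carrier A" "star A y = y" "y \<otimes> h = h \<otimes> y" using y by (auto simp: Y_def)
  have "y \<oplus> y = (1/2 + 1/2) \<odot> (h \<otimes> h \<oplus> y \<otimes> y)"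
    using y(2) yA h by (subst smult_add_left) (simp_all add: g_def)
  then have sq: "h \<otimes> h \<oplus> y \<otimes> y = y \<oplus> y" using h yA by simp
  show thesis
  proof
    show "\<one> \<ominus> y \<in> carrier A" "star A (\<one> \<ominus> y) = \<one> \<ominus> y"
      using yA by (simp_all add: star_minus)
    show "(\<one> \<ominus> y) \<otimes> h = h \<otimes> (\<one> \<ominus> y)"
      using yA h by (simp add: mult_minus_left mult_minus_right)
    have "(\<one> \<ominus> y) \<otimes> (\<one> \<ominus> y) = (\<one> \<ominus> y) \<ominus> (y \<ominus> y \<otimes> y)"
      using yA by (simp add: mult_minus_left mult_minus_right)
    then have "h \<otimes> h \<oplus> (\<one> \<ominus> y) \<otimes> (\<one> \<ominus> y) = (h \<otimes> h \<oplus> y \<otimes> y) \<oplus> (\<one> \<ominus> (y \<oplus> y))"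
      using yA(1) h(1) by simp algebra
    also have "\<dots> = \<one>" unfolding sq using yA(1) by algebra
    finally show "h \<otimes> h \<oplus> (\<one> \<ominus> y) \<otimes> (\<one> \<ominus> y) = \<one>" .
  qed
qed

text \<open>The element \<open>h\<close> of the preceding lemma is the real part of the unitary \<open>h + i s\<close>. A unital
*-homomorphism maps unitaries to unitaries, which have norm at most 1, so it maps \<open>h\<close> into the unit
ball. Rescaling settles self-adjoint elements, and the C*-identity settles the rest.\<close>

lemma unital_star_hom_contractive:
  assumes B: "unital_cstar_algebra B" and \<phi>: "\<phi> \<in> star_hom A B" and \<phi>1: "\<phi> \<one> = \<one>\<^bsub>B\<^esub>"
    and x: "x \<in> carrier A"
  shows "cnorm B (\<phi> x) \<le> cnorm A x"
proof -
  interpret B: unital_cstar_algebra B by (rule B)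
  have cl: "\<phi> y \<in> carrier B" if "y \<in> carrier A" for y
    using \<phi> that by (auto simp: star_hom_def)
  have add: "\<phi> (y \<oplus> z) = \<phi> y \<oplus>\<^bsub>B\<^esub> \<phi> z" and mult: "\<phi> (y \<otimes> z) = \<phi> y \<otimes>\<^bsub>B\<^esub> \<phi> z"
    if "y \<in> carrier A" "z \<in> carrier A" for y z using \<phi> that by (auto simp: star_hom_def)
  have smult: "\<phi> (c \<odot> y) = c \<odot>\<^bsub>B\<^esub> \<phi> y" and star: "\<phi> (star A y) = star B (\<phi> y)"
    if "y \<in> carrier A" for y c using \<phi> that by (auto simp: star_hom_def)
  have unitary: "cnorm B (\<phi> w) \<le> 1" if "w \<in> carrier A" "star A w \<otimes> w = \<one>" for w
    using B.isometry_cnorm_le[of "\<phi> w"] mult[of "star A w" w] star[of w] cl \<phi>1 that by simp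
  have small: "cnorm B (\<phi> h) \<le> 1" if h: "h \<in> carrier A" "star A h = h" "cnorm A h < 1" for h
  proof -
    obtain s where s: "s \<in> carrier A" "star A s = s" "s \<otimes> h = h \<otimes> s" "h \<otimes> h \<oplus> s \<otimes> s = \<one>"
      using selfadjoint_complement[OF h] .
    define w where "w = h \<oplus> \<i> \<odot> s"
    have w: "w \<in> carrier A" using h s by (simp add: w_def)
    have sw: "star A w = h \<oplus> (-\<i>) \<odot> s" using h s by (simp add: w_def star_add star_smult)
    have "star A w \<otimes> w = (h \<otimes> h \<oplus> \<i> \<odot> (h \<otimes> s)) \<oplus> ((-\<i>) \<odot> (h \<otimes> s) \<oplus> s \<otimes> s)"
      using h s
      by (simp add: sw) (simp add: w_def mult_add_left mult_add_right smult_mult_left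
          smult_mult_right smult_smult smult_add_right M.add.m_ac)
    also have "\<dots> = h \<otimes> h \<oplus> (\<i> + - \<i>) \<odot> (h \<otimes> s) \<oplus> s \<otimes> s"
      using h s by (simp only: smult_add_left mult_closed) (simp add: M.add.m_assoc)
    also have "\<dots> = \<one>" using h s by simp
    finally have "cnorm B (\<phi> w) \<le> 1" using unitary w by simp
    moreover have "h = (1/2) \<odot> (w \<oplus> star A w)"
    proof -
      have "w \<oplus> star A w = (h \<oplus> \<i> \<odot> s) \<oplus> (h \<oplus> (-\<i>) \<odot> s)"
        by (subst sw) (simp add: w_def)
      also have "\<dots> = (h \<oplus> h) \<oplus> (\<i> \<odot> s \<oplus> (-\<i>) \<odot> s)"
        using h s by (simp add: M.add.m_ac)
      also have "\<i> \<odot> s \<oplus> (-\<i>) \<odot> s = \<zero>"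
        using smult_add_left[of s \<i> "-\<i>"] s by simp
      also have "(h \<oplus> h) \<oplus> \<zero> = (1 + 1) \<odot> h"
        using h smult_add_left[of h 1 1] by simp
      finally show ?thesis using h by (simp add: smult_smult)
    qed
    then have "\<phi> h = (1/2) \<odot>\<^bsub>B\<^esub> (\<phi> w \<oplus>\<^bsub>B\<^esub> star B (\<phi> w))"
      using w by (metis add smult star star_closed M.add.m_closed)
    then have "cnorm B (\<phi> h) = cnorm B (\<phi> w \<oplus>\<^bsub>B\<^esub> star B (\<phi> w)) / 2"
      using w cl by (simp add: B.cnorm_smult)
    also have "\<dots> \<le> (cnorm B (\<phi> w) + cnorm B (\<phi> w)) / 2"
      using B.cnorm_triangle[of "\<phi> w" "star B (\<phi> w)"] w cl by simp
    finally show ?thesis using \<open>cnorm B (\<phi> w) \<le> 1\<close> by simp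
  qed
  have sa: "cnorm B (\<phi> h) \<le> cnorm A h" if h: "h \<in> carrier A" "star A h = h" for h
  proof (rule dense_ge)
    fix c assume c: "cnorm A h < c"
    then have c0: "c > 0" using cnorm_nonneg[OF h(1)] by simp
    have "cnorm B (\<phi> (complex_of_real (1/c) \<odot> h)) \<le> 1"
      using h c c0 by (intro small) (simp_all add: star_smult cnorm_smult norm_divide)
    then show "cnorm B (\<phi> h) \<le> c"
      using h c0 cl by (simp add: smult B.cnorm_smult norm_divide divide_le_eq)
  qed
  have "(cnorm B (\<phi> x))\<^sup>2 = cnorm B (\<phi> (star A x \<otimes> x))"
    using B.cstar_identity[of "\<phi> x"] x cl by (simp add: mult star)
  also have "\<dots> \<le> cnorm A (star A x \<otimes> x)"
    using x by (intro sa) (simp_all add: star_mult)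
  also have "\<dots> = (cnorm A x)\<^sup>2" using x by (rule cstar_identity)
  finally show ?thesis using cnorm_nonneg[OF x] by (rule power2_le_imp_le)
qed

end

section \<open>Generated subalgebras\<close>

context cstar_algebra
begin

text \<open>Commuting with \<open>star A z\<close> as well as with \<open>z\<close> is what makes the set closed under the involution.\<close>

lemma cstar_subalgebra_commutant:
  assumes z: "z \<in> carrier A"
  shows "cstar_subalgebra
    {x \<in> carrier A. z \<otimes> x = x \<otimes> z \<and> star A z \<otimes> x = x \<otimes> star A z} A" (is "cstar_subalgebra ?B A")
  unfolding cstar_subalgebra_def
proof (intro conjI ballI allI)
  fix x y assume x: "x \<in> ?B" and y: "y \<in> ?B"
  show "x \<oplus> y \<in> ?B" using x y z by (simp add: mult_add_left mult_add_right)
  have "w \<otimes> (x \<otimes> y) = (x \<otimes> y) \<otimes> w"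
    if "w \<otimes> x = x \<otimes> w" "w \<otimes> y = y \<otimes> w" "w \<in> carrier A" for w
    using x y that by simp (metis mult_assoc)
  then show "x \<otimes> y \<in> ?B" using x y z by simp
next
  fix x c assume x: "x \<in> ?B"
  show "c \<odot> x \<in> ?B" using x z by (simp add: smult_mult_left smult_mult_right)
next
  fix x assume x: "x \<in> ?B"
  have "star A z \<otimes> star A x = star A x \<otimes> star A z" "z \<otimes> star A x = star A x \<otimes> z"
    using x z star_mult[of z x] star_mult[of x z] star_mult[of "star A z" x] star_mult[of x "star A z"]
    by simp_all
  then show "star A x \<in> ?B" using x by simp
next
  show "closedin (cstar_topology A) ?B"
  proof (rule closedinI)
    fix x assume x: "x \<in> carrier A" and close: "\<And>\<epsilon>. \<epsilon> > 0 \<Longrightarrow> \<exists>p\<in>?B. cnorm A (x \<ominus> p) < \<epsilon>"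
    have "w \<otimes> x = x \<otimes> w"
      if w: "w \<in> carrier A" and "\<And>p. p \<in> ?B \<Longrightarrow> w \<otimes> p = p \<otimes> w" for w
    proof (rule lipschitz_eq_limit[where k="cnorm A w" and l="cnorm A w" and L="\<lambda>x. w \<otimes> x"
          and R="\<lambda>x. x \<otimes> w", OF x])
      show "\<exists>p\<in>carrier A. cnorm A (x \<ominus> p) < \<epsilon> \<and> w \<otimes> p = p \<otimes> w" if "\<epsilon> > 0" for \<epsilon>
        using close[OF that] \<open>\<And>p. p \<in> ?B \<Longrightarrow> w \<otimes> p = p \<otimes> w\<close> by blast
      fix y assume y: "y \<in> carrier A"
      show "cnorm A (x \<otimes> w \<ominus> y \<otimes> w) \<le> cnorm A w * cnorm A (x \<ominus> y)"
        using cnorm_mult[of "x \<ominus> y" w] x y w by (simp add: mult_minus_left mult.commute)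
      show "cnorm A (w \<otimes> x \<ominus> w \<otimes> y) \<le> cnorm A w * cnorm A (x \<ominus> y)"
        using cnorm_mult[of w "x \<ominus> y"] x y w by (simp add: mult_minus_right)
    qed (use w in \<open>auto simp: cnorm_nonneg\<close>)
    then show "x \<in> ?B" using x z by simp
  qed auto
qed (use z in auto)

lemma cstar_subalgebra_unit:
  assumes e: "e \<in> carrier A" "star A e = e"
  shows "cstar_subalgebra {x \<in> carrier A. e \<otimes> x = x \<and> x \<otimes> e = x} A" (is "cstar_subalgebra ?B A")
  unfolding cstar_subalgebra_def
proof (intro conjI ballI allI)
  fix x y assume x: "x \<in> ?B" and y: "y \<in> ?B"
  show "x \<oplus> y \<in> ?B" using x y e by (simp add: mult_add_left mult_add_right)
  show "x \<otimes> y \<in> ?B" using x y e by (simp add: mult_assoc) (metis mult_assoc)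
next
  fix x c assume x: "x \<in> ?B"
  show "c \<odot> x \<in> ?B" using x e by (simp add: smult_mult_left smult_mult_right)
next
  fix x assume x: "x \<in> ?B"
  show "star A x \<in> ?B" using x e star_mult[of e x] star_mult[of x e] by simp
next
  show "closedin (cstar_topology A) ?B"
  proof (rule closedinI)
    fix x assume x: "x \<in> carrier A" and close: "\<And>\<epsilon>. \<epsilon> > 0 \<Longrightarrow> \<exists>p\<in>?B. cnorm A (x \<ominus> p) < \<epsilon>"
    have 1: "e \<otimes> x = x"
    proof (rule lipschitz_eq_limit[where k="cnorm A e" and l=1 and L="\<lambda>x. e \<otimes> x" and R="\<lambda>x. x", OF x])
      show "\<exists>p\<in>carrier A. cnorm A (x \<ominus> p) < \<epsilon> \<and> e \<otimes> p = p" if "\<epsilon> > 0" for \<epsilon>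
        using close[OF that] by blast
      fix y assume y: "y \<in> carrier A"
      show "cnorm A (e \<otimes> x \<ominus> e \<otimes> y) \<le> cnorm A e * cnorm A (x \<ominus> y)"
        using cnorm_mult[of e "x \<ominus> y"] x y e by (simp add: mult_minus_right)
    qed (use e in \<open>auto simp: cnorm_nonneg\<close>)
    have 2: "x \<otimes> e = x"
    proof (rule lipschitz_eq_limit[where k="cnorm A e" and l=1 and L="\<lambda>x. x \<otimes> e" and R="\<lambda>x. x", OF x])
      show "\<exists>p\<in>carrier A. cnorm A (x \<ominus> p) < \<epsilon> \<and> p \<otimes> e = p" if "\<epsilon> > 0" for \<epsilon>
        using close[OF that] by blast
      fix y assume y: "y \<in> carrier A"
      show "cnorm A (x \<otimes> e \<ominus> y \<otimes> e) \<le> cnorm A e * cnorm A (x \<ominus> y)"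
        using cnorm_mult[of "x \<ominus> y" e] x y e by (simp add: mult_minus_left mult.commute)
    qed (use e in \<open>auto simp: cnorm_nonneg\<close>)
    show "x \<in> ?B" using 1 2 x by simp
  qed auto
qed (use e in auto)

text \<open>Applied to the linear span of the monomials, this turns the assumption that a family generates \<open>A\<close> as
a C*-algebra into norm approximation by explicit finite sums.\<close>

lemma cstar_subalgebra_closure:
  assumes M: "M \<subseteq> carrier A" "\<zero> \<in> M"
    and add: "\<And>x y. \<lbrakk>x \<in> M; y \<in> M\<rbrakk> \<Longrightarrow> x \<oplus> y \<in> M"
    and mult: "\<And>x y. \<lbrakk>x \<in> M; y \<in> M\<rbrakk> \<Longrightarrow> x \<otimes> y \<in> M"
    and smult: "\<And>c x. x \<in> M \<Longrightarrow> c \<odot> x \<in> M"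
    and star: "\<And>x. x \<in> M \<Longrightarrow> star A x \<in> M"
  shows "cstar_subalgebra {x \<in> carrier A. \<forall>\<epsilon>>0. \<exists>p\<in>M. cnorm A (x \<ominus> p) < \<epsilon>} A"
    (is "cstar_subalgebra ?B A")
  unfolding cstar_subalgebra_def
proof (intro conjI ballI allI)
  show "\<zero> \<in> ?B" using M(2) by (auto intro!: bexI[of _ \<zero>] simp: a_minus_def minus_smult)
next
  fix x y assume x: "x \<in> ?B" and y: "y \<in> ?B"
  have "\<exists>p\<in>M. cnorm A ((x \<oplus> y) \<ominus> p) < \<epsilon>" if "\<epsilon> > 0" for \<epsilon>
  proof -
    obtain p q where pq: "p \<in> M" "cnorm A (x \<ominus> p) < \<epsilon>/2" "q \<in> M" "cnorm A (y \<ominus> q) < \<epsilon>/2"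
      using x y \<open>\<epsilon> > 0\<close> half_gt_zero by blast
    have c: "x \<in> carrier A" "y \<in> carrier A" "p \<in> carrier A" "q \<in> carrier A" using x y pq M by auto
    have "(x \<oplus> y) \<ominus> (p \<oplus> q) = (x \<ominus> p) \<oplus> (y \<ominus> q)"
      using c by (simp add: a_minus_def M.minus_add M.add.m_ac)
    then show ?thesis
      using cnorm_triangle[of "x \<ominus> p" "y \<ominus> q"] c pq add[of p q] by (intro bexI[of _ "p \<oplus> q"]) auto
  qed
  then show "x \<oplus> y \<in> ?B" using x y by blast
  have "\<exists>p\<in>M. cnorm A ((x \<otimes> y) \<ominus> p) < \<epsilon>" if \<epsilon>: "\<epsilon> > 0" for \<epsilon>
  proof -
    define \<delta> where "\<delta> = min 1 (\<epsilon> / (cnorm A x + cnorm A y + 2))"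
    have nn: "cnorm A x \<ge> 0" "cnorm A y \<ge> 0" using x y by (auto simp: cnorm_nonneg)
    then have "\<delta> > 0" using \<epsilon> by (simp add: \<delta>_def)
    then obtain p q where pq: "p \<in> M" "cnorm A (x \<ominus> p) < \<delta>" "q \<in> M" "cnorm A (y \<ominus> q) < \<delta>"
      using x y by blast
    have c: "x \<in> carrier A" "y \<in> carrier A" "p \<in> carrier A" "q \<in> carrier A" using x y pq M by auto
    have "cnorm A q \<le> cnorm A (q \<ominus> y) + cnorm A y"
    proof -
      have "q = (q \<ominus> y) \<oplus> y" using c by (simp add: a_minus_def M.add.m_assoc M.l_neg)
      then show ?thesis using cnorm_triangle[of "q \<ominus> y" y] c by simp
    qed
    then have q: "cnorm A q \<le> cnorm A y + 1"
      using pq c by (simp add: cnorm_minus_commute \<delta>_def)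
    have "x \<otimes> y \<ominus> p \<otimes> q = x \<otimes> (y \<ominus> q) \<oplus> (x \<ominus> p) \<otimes> q"
      using c by (simp add: mult_minus_left mult_minus_right add_minus_cancel_mid[symmetric])
    then have "cnorm A (x \<otimes> y \<ominus> p \<otimes> q) \<le> cnorm A x * cnorm A (y \<ominus> q) + cnorm A (x \<ominus> p) * cnorm A q"
      using cnorm_triangle[of "x \<otimes> (y \<ominus> q)" "(x \<ominus> p) \<otimes> q"] cnorm_mult[of x "y \<ominus> q"]
        cnorm_mult[of "x \<ominus> p" q] c by simp
    also have "\<dots> \<le> cnorm A x * \<delta> + \<delta> * (cnorm A y + 1)"
      using pq c q nn \<open>\<delta> > 0\<close> by (intro add_mono mult_mono) (auto simp: cnorm_nonneg)
    also have "\<dots> < \<delta> * (cnorm A x + cnorm A y + 2)"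
      using \<open>\<delta> > 0\<close> by (simp add: algebra_simps)
    also have "\<dots> \<le> \<epsilon> / (cnorm A x + cnorm A y + 2) * (cnorm A x + cnorm A y + 2)"
      using nn by (intro mult_right_mono) (auto simp: \<delta>_def)
    also have "\<dots> = \<epsilon>" using nn by simp
    finally show ?thesis using mult pq by blast
  qed
  then show "x \<otimes> y \<in> ?B" using x y by blast
next
  fix c x assume x: "x \<in> ?B"
  have "\<exists>p\<in>M. cnorm A (c \<odot> x \<ominus> p) < \<epsilon>" if \<epsilon>: "\<epsilon> > 0" for \<epsilon>
  proof -
    have "\<epsilon> / (cmod c + 1) > 0" using \<epsilon> by (simp add: add_nonneg_pos)
    then obtain p where p: "p \<in> M" "cnorm A (x \<ominus> p) < \<epsilon> / (cmod c + 1)" using x by blast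
    have pc: "p \<in> carrier A" "x \<in> carrier A" using p x M by auto
    have "cnorm A (c \<odot> x \<ominus> c \<odot> p) = cmod c * cnorm A (x \<ominus> p)"
      using pc by (simp add: smult_minus_right[symmetric] cnorm_smult)
    also have "\<dots> \<le> (cmod c) * (\<epsilon> / (cmod c + 1))" using p by (intro mult_left_mono) auto
    also have "\<dots> < \<epsilon>" using \<epsilon> by (simp add: divide_simps add_nonneg_pos)
    finally show ?thesis using smult p by blast
  qed
  then show "c \<odot> x \<in> ?B" using x by blast
next
  fix x assume x: "x \<in> ?B"
  have "\<exists>p\<in>M. cnorm A (star A x \<ominus> p) < \<epsilon>" if \<epsilon>: "\<epsilon> > 0" for \<epsilon>
  proof -
    obtain p where p: "p \<in> M" "cnorm A (x \<ominus> p) < \<epsilon>" using x \<epsilon> by blast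
    then have "cnorm A (star A x \<ominus> star A p) < \<epsilon>"
      using x M by (simp add: star_minus[symmetric] subset_iff)
    then show ?thesis using star p by blast
  qed
  then show "star A x \<in> ?B" using x by blast
next
  show "closedin (cstar_topology A) ?B"
  proof (rule closedinI)
    fix x assume x: "x \<in> carrier A" and close: "\<And>\<epsilon>. \<epsilon> > 0 \<Longrightarrow> \<exists>p\<in>?B. cnorm A (x \<ominus> p) < \<epsilon>"
    have "\<exists>p\<in>M. cnorm A (x \<ominus> p) < \<epsilon>" if \<epsilon>: "\<epsilon> > 0" for \<epsilon>
    proof -
      obtain y where y: "y \<in> ?B" "cnorm A (x \<ominus> y) < \<epsilon>/2" using close[of "\<epsilon>/2"] \<epsilon> by auto
      then obtain p where p: "p \<in> M" "cnorm A (y \<ominus> p) < \<epsilon>/2" using \<epsilon> half_gt_zero by blast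
      then show ?thesis
        using y x M cnorm_minus_triangle[of x y p] by (intro bexI[of _ p]) auto
    qed
    then show "x \<in> ?B" using x by blast
  qed auto
qed auto

end

section \<open>A copy of an algebra on a sum type\<close>

text \<open>The universal property speaks about targets with carrier in one particular sum type. Moving an
  algebra there along \<^const>\<open>Inl\<close> makes the algebra itself available as a target.\<close>

definition inl_copy :: "'a cstar \<Rightarrow> ('a + 'b) cstar" where
  "inl_copy A =
     \<lparr>carrier = Inl ` carrier A,
      monoid.mult = (\<lambda>x y. Inl (projl x \<otimes>\<^bsub>A\<^esub> projl y)), monoid.one = Inl \<one>\<^bsub>A\<^esub>,
      ring.zero = Inl \<zero>\<^bsub>A\<^esub>, ring.add = (\<lambda>x y. Inl (projl x \<oplus>\<^bsub>A\<^esub> projl y)),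
      module.smult = (\<lambda>c x. Inl (c \<odot>\<^bsub>A\<^esub> projl x)),
      star = (\<lambda>x. Inl (star A (projl x))), cnorm = (\<lambda>x. cnorm A (projl x))\<rparr>"

lemma inl_copy_simps [simp]:
  "carrier (inl_copy A) = Inl ` carrier A"
  "x \<otimes>\<^bsub>inl_copy A\<^esub> y = Inl (projl x \<otimes>\<^bsub>A\<^esub> projl y)"
  "\<zero>\<^bsub>inl_copy A\<^esub> = Inl \<zero>\<^bsub>A\<^esub>"
  "x \<oplus>\<^bsub>inl_copy A\<^esub> y = Inl (projl x \<oplus>\<^bsub>A\<^esub> projl y)"
  "c \<odot>\<^bsub>inl_copy A\<^esub> x = Inl (c \<odot>\<^bsub>A\<^esub> projl x)"
  "star (inl_copy A) x = Inl (star A (projl x))"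
  "cnorm (inl_copy A) x = cnorm A (projl x)"
  by (simp_all add: inl_copy_def)

context cstar_algebra
begin

lemma module_inl_copy: "module (ring_of_type_algebra :: complex ring) (inl_copy A)"
proof (rule moduleI)
  show "cring (ring_of_type_algebra :: complex ring)" by (rule R.is_cring)
  show "abelian_group (inl_copy A)"
  proof (rule abelian_groupI)
    fix x assume "x \<in> carrier (inl_copy A)"
    then show "\<exists>y\<in>carrier (inl_copy A). y \<oplus>\<^bsub>inl_copy A\<^esub> x = \<zero>\<^bsub>inl_copy A\<^esub>"
      by (auto intro!: bexI[of _ "\<ominus> projl x"] simp: M.l_neg)
  qed (auto simp: M.add.m_ac)
qed (auto simp: ring_of_type_algebra_def smult_add_left smult_add_right smult_smult)

lemma cdist_inl_copy:
  fixes a b :: "'a + 'c"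
  shows "cdist (inl_copy A) a b =
     (if a \<in> Inl ` carrier A \<and> b \<in> Inl ` carrier A then cdist A (projl a) (projl b) else 0)"
proof -
  interpret C: module "ring_of_type_algebra :: complex ring" "inl_copy A :: ('a + 'c) cstar"
    by (rule module_inl_copy)
  have "Inl x \<ominus>\<^bsub>inl_copy A\<^esub> Inl y = (Inl (x \<ominus> y) :: 'a + 'c)" if "x \<in> carrier A" "y \<in> carrier A" for x y
  proof -
    have "\<ominus>\<^bsub>inl_copy A\<^esub> Inl y = (Inl (\<ominus> y) :: 'a + 'c)"
      using that by (intro C.M.minus_equality) (auto simp: M.l_neg)
    then show ?thesis by (simp add: a_minus_def)
  qed
  then show ?thesis by (auto simp: cdist_def)
qed

lemma cstar_algebra_inl_copy: "cstar_algebra (inl_copy A :: ('a + 'b) cstar)"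
proof (intro cstar_algebra.intro cstar_algebra_axioms.intro module_inl_copy)
  let ?M = "Inl ` carrier A :: ('a + 'b) set" and ?d = "cdist (inl_copy A :: ('a + 'b) cstar)"
  interpret C: Metric_space ?M ?d
  proof
    show "0 \<le> ?d x y" "?d x y = ?d y x" for x y
      by (auto simp: cdist_inl_copy metric.commute)
    show "?d x y = 0 \<longleftrightarrow> x = y" if "x \<in> ?M" "y \<in> ?M" for x y
      using that by (auto simp: cdist_inl_copy)
    show "?d x z \<le> ?d x y + ?d y z" if "x \<in> ?M" "y \<in> ?M" "z \<in> ?M" for x y z
      using that metric.triangle by (auto simp: cdist_inl_copy)
  qed
  show "Metric_space.mcomplete (carrier (inl_copy A :: ('a + 'b) cstar)) ?d"
    unfolding inl_copy_simps C.mcomplete_def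
  proof (intro allI impI)
    fix \<sigma> assume \<sigma>: "C.MCauchy \<sigma>"
    have r: "\<sigma> n \<in> ?M" for n using \<sigma> by (auto simp: C.MCauchy_def)
    have d: "cdist A (projl (\<sigma> n)) (projl (\<sigma> m)) = ?d (\<sigma> n) (\<sigma> m)" for n m
      using r by (simp add: cdist_inl_copy)
    have "projl (\<sigma> n) \<in> carrier A" for n using r[of n] by auto
    then have "metric.MCauchy (projl \<circ> \<sigma>)"
      using \<sigma> unfolding metric.MCauchy_def C.MCauchy_def by (auto simp: d)
    then obtain x where x: "limitin metric.mtopology (projl \<circ> \<sigma>) x sequentially"
      using complete unfolding metric.mcomplete_def by blast
    then have xA: "x \<in> carrier A" by (simp add: metric.limit_metric_sequentially)
    have "?d (\<sigma> n) (Inl x) = cdist A (projl (\<sigma> n)) x" for n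
      using r xA by (simp add: cdist_inl_copy)
    moreover have "\<exists>N. \<forall>n\<ge>N. cdist A (projl (\<sigma> n)) x < \<epsilon>" if "\<epsilon> > 0" for \<epsilon>
      using x that unfolding metric.limit_metric_sequentially comp_apply by meson
    ultimately have "limitin C.mtopology \<sigma> (Inl x) sequentially"
      using r xA unfolding C.limit_metric_sequentially by simp
    then show "\<exists>x. limitin C.mtopology \<sigma> x sequentially" by blast
  qed
qed (auto simp: mult_assoc mult_add_left mult_add_right smult_mult_left smult_mult_right star_add
    star_smult star_mult cnorm_nonneg cnorm_eq_0 cnorm_triangle cnorm_smult cnorm_mult cstar_identity)

lemma finsum_inl_copy:
  assumes "finite I" "f \<in> I \<rightarrow> carrier A"
  shows "finsum (inl_copy A :: ('a + 'b) cstar) (\<lambda>i. Inl (f i)) I = Inl (finsum A f I)"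
proof -
  interpret C: module "ring_of_type_algebra :: complex ring" "inl_copy A :: ('a + 'b) cstar"
    by (rule module_inl_copy)
  show ?thesis using assms
  proof (induction I rule: finite_induct)
    case empty show ?case using C.M.finsum_empty by simp
  next
    case (insert i I)
    then have "f \<in> I \<rightarrow> carrier A" "f i \<in> carrier A" by auto
    moreover have "(\<lambda>i. Inl (f i)) \<in> I \<rightarrow> carrier (inl_copy A :: ('a + 'b) cstar)"
      using calculation by auto
    ultimately show ?case using insert C.M.finsum_insert[of I i "\<lambda>i. Inl (f i)"] by simp
  qed
qed

end

section \<open>Homomorphisms and gauge automorphisms of a graph algebra\<close>

lemma star_homD:
  assumes "\<phi> \<in> star_hom A B"
  shows "x \<in> carrier A \<Longrightarrow> \<phi> x \<in> carrier B"
    and "\<lbrakk>x \<in> carrier A; y \<in> carrier A\<rbrakk> \<Longrightarrow> \<phi> (x \<oplus>\<^bsub>A\<^esub> y) = \<phi> x \<oplus>\<^bsub>B\<^esub> \<phi> y"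
    and "\<lbrakk>x \<in> carrier A; y \<in> carrier A\<rbrakk> \<Longrightarrow> \<phi> (x \<otimes>\<^bsub>A\<^esub> y) = \<phi> x \<otimes>\<^bsub>B\<^esub> \<phi> y"
    and "x \<in> carrier A \<Longrightarrow> \<phi> (c \<odot>\<^bsub>A\<^esub> x) = c \<odot>\<^bsub>B\<^esub> \<phi> x"
    and "x \<in> carrier A \<Longrightarrow> \<phi> (star A x) = star B (\<phi> x)"
  using assms by (auto simp: star_hom_def)

lemma cuntz_krieger_familyD:
  assumes "cuntz_krieger_family E A P S"
  shows "v \<in> verts E \<Longrightarrow> projection A (P v)"
    and "\<lbrakk>v \<in> verts E; w \<in> verts E; v \<noteq> w\<rbrakk> \<Longrightarrow> P v \<otimes>\<^bsub>A\<^esub> P w = \<zero>\<^bsub>A\<^esub>"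
    and "e \<in> arcs E \<Longrightarrow> partial_isometry A (S e)"
    and "e \<in> arcs E \<Longrightarrow> star A (S e) \<otimes>\<^bsub>A\<^esub> S e = P (head E e)"
    and "\<lbrakk>e \<in> arcs E; f \<in> arcs E; e \<noteq> f\<rbrakk> \<Longrightarrow> star A (S e) \<otimes>\<^bsub>A\<^esub> S f = \<zero>\<^bsub>A\<^esub>"
    and "e \<in> arcs E \<Longrightarrow> projection_le A (S e \<otimes>\<^bsub>A\<^esub> star A (S e)) (P (tail E e))"
    and "\<lbrakk>v \<in> verts E; finite (out_arcs E v); out_arcs E v \<noteq> {}\<rbrakk> \<Longrightarrow>
      P v = (\<Oplus>\<^bsub>A\<^esub>e\<in>out_arcs E v. S e \<otimes>\<^bsub>A\<^esub> star A (S e))"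
proof -
  note D = assms[unfolded cuntz_krieger_family_def]
  show "v \<in> verts E \<Longrightarrow> projection A (P v)"
    by (rule D[THEN conjunct1, rule_format])
  show "\<lbrakk>v \<in> verts E; w \<in> verts E; v \<noteq> w\<rbrakk> \<Longrightarrow> P v \<otimes>\<^bsub>A\<^esub> P w = \<zero>\<^bsub>A\<^esub>"
    by (rule D[THEN conjunct2, THEN conjunct1, rule_format])
  note D = D[THEN conjunct2, THEN conjunct2]
  show "e \<in> arcs E \<Longrightarrow> partial_isometry A (S e)"
    by (rule D[THEN conjunct1, rule_format])
  show "e \<in> arcs E \<Longrightarrow> star A (S e) \<otimes>\<^bsub>A\<^esub> S e = P (head E e)"
    by (rule D[THEN conjunct2, THEN conjunct1, rule_format])
  note D = D[THEN conjunct2, THEN conjunct2]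
  show "\<lbrakk>e \<in> arcs E; f \<in> arcs E; e \<noteq> f\<rbrakk> \<Longrightarrow> star A (S e) \<otimes>\<^bsub>A\<^esub> S f = \<zero>\<^bsub>A\<^esub>"
    by (rule D[THEN conjunct1, rule_format])
  show "e \<in> arcs E \<Longrightarrow> projection_le A (S e \<otimes>\<^bsub>A\<^esub> star A (S e)) (P (tail E e))"
    by (rule D[THEN conjunct2, THEN conjunct1, rule_format])
  show "\<lbrakk>v \<in> verts E; finite (out_arcs E v); out_arcs E v \<noteq> {}\<rbrakk> \<Longrightarrow>
      P v = (\<Oplus>\<^bsub>A\<^esub>e\<in>out_arcs E v. S e \<otimes>\<^bsub>A\<^esub> star A (S e))"
    by (rule D[THEN conjunct2, THEN conjunct2, rule_format, OF _ conjI])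
qed

lemma (in cstar_algebra) cuntz_krieger_inl_copy:
  assumes "wf_digraph E" "cuntz_krieger_family E A Q T"
  shows "cuntz_krieger_family E (inl_copy A :: ('a + 'b) cstar) (\<lambda>v. Inl (Q v)) (\<lambda>e. Inl (T e))"
proof -
  note D = cuntz_krieger_familyD[OF assms(2)]
  have T: "T e \<in> carrier A" if "e \<in> arcs E" for e
    using D(3)[OF that] by (simp add: partial_isometry_def)
  have sum: "(\<Oplus>\<^bsub>inl_copy A :: ('a + 'b) cstar\<^esub>e\<in>out_arcs E v. Inl (T e \<otimes> star A (T e)))
      = Inl (\<Oplus>e\<in>out_arcs E v. T e \<otimes> star A (T e))" if "finite (out_arcs E v)" for v
    using finsum_inl_copy[OF that, of "\<lambda>e. T e \<otimes> star A (T e)"] T by simp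
  have proj: "projection (inl_copy A :: ('a + 'b) cstar) (Inl x)" if "projection A x" for x
    using that by (simp add: projection_def)
  show ?thesis
    unfolding cuntz_krieger_family_def
  proof (intro conjI ballI impI)
    fix e assume e: "e \<in> arcs E"
    show "partial_isometry (inl_copy A :: ('a + 'b) cstar) (Inl (T e))"
      using D(3)[OF e] by (simp add: partial_isometry_def)
    show "projection_le (inl_copy A :: ('a + 'b) cstar)
        (Inl (T e) \<otimes>\<^bsub>inl_copy A\<^esub> star (inl_copy A) (Inl (T e))) (Inl (Q (tail E e)))"
      using D(6)[OF e] proj by (simp add: projection_le_def)
  next
    fix v assume "v \<in> verts E" "finite (out_arcs E v) \<and> out_arcs E v \<noteq> {}"
    then show "Inl (Q v) = (\<Oplus>\<^bsub>inl_copy A :: ('a + 'b) cstar\<^esub>e\<in>out_arcs E v.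
        Inl (T e) \<otimes>\<^bsub>inl_copy A\<^esub> star (inl_copy A) (Inl (T e)))"
      using sum D(7)[of v] by simp
  qed (use D proj in simp_all)
qed

lemma graph_cstar_endomorphism:
  fixes A :: "'a cstar"
  assumes "wf_digraph E" "graph_cstar_algebra E A P S" "cuntz_krieger_family E A Q T"
  obtains \<phi> where "\<phi> \<in> star_hom A A" "\<And>v. v \<in> verts E \<Longrightarrow> \<phi> (P v) = Q v"
    "\<And>e. e \<in> arcs E \<Longrightarrow> \<phi> (S e) = T e"
proof -
  interpret cstar_algebra A using assms(2) by (simp add: graph_cstar_algebra_def)
  let ?B = "inl_copy A :: ('a + real) cstar"
  note assms(2)[unfolded graph_cstar_algebra_def, THEN conjunct2, THEN conjunct2, THEN conjunct2,
      rule_format, of ?B, OF conjI[OF cstar_algebra_inl_copy cuntz_krieger_inl_copy[OF assms(1,3)]]]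
  then obtain \<psi> where \<psi>: "\<psi> \<in> star_hom A ?B" "\<forall>v\<in>verts E. \<psi> (P v) = Inl (Q v)"
    "\<forall>e\<in>arcs E. \<psi> (S e) = Inl (T e)" by (elim bexE conjE)
  have "projl (\<psi> x) \<in> carrier A" if "x \<in> carrier A" for x
    using star_homD(1)[OF \<psi>(1) that] by auto
  then have "(\<lambda>x. projl (\<psi> x)) \<in> star_hom A A"
    using \<psi>(1) by (simp add: star_hom_def)
  then show thesis using that \<psi>(2,3) by simp
qed

lemma (in cstar_algebra) cuntz_krieger_gauge:
  assumes CK: "cuntz_krieger_family E A P S" and t: "cmod t = 1"
  shows "cuntz_krieger_family E A P (\<lambda>e. t \<odot> S e)"
proof -
  have tt: "cnj t * t = 1" "t * cnj t = 1"
    using t complex_norm_square[of t] by (simp_all add: mult.commute)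
  have S: "S e \<in> carrier A" if "e \<in> arcs E" for e
    using cuntz_krieger_familyD(3)[OF CK that] by (simp add: partial_isometry_def)
  have 1: "(t \<odot> S e) \<otimes> star A (t \<odot> S e) = S e \<otimes> star A (S e)" if "e \<in> arcs E" for e
    using S[OF that] tt by (simp add: star_smult smult_mult_left smult_mult_right smult_smult)
  have 2: "star A (t \<odot> S e) \<otimes> (t \<odot> S f) = star A (S e) \<otimes> S f" if "e \<in> arcs E" "f \<in> arcs E" for e f
    using S[OF that(1)] S[OF that(2)] tt
    by (simp add: star_smult smult_mult_left smult_mult_right smult_smult)
  have 3: "S e \<otimes> star A (S e) \<otimes> (t \<odot> S e) = t \<odot> (S e \<otimes> star A (S e) \<otimes> S e)"
    if "e \<in> arcs E" for e
    using S[OF that] by (simp add: smult_mult_right)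
  have 4: "(\<Oplus>e\<in>out_arcs E v. (t \<odot> S e) \<otimes> star A (t \<odot> S e)) = (\<Oplus>e\<in>out_arcs E v. S e \<otimes> star A (S e))"
    for v
    using S by (intro M.finsum_cong') (auto simp: 1)
  show ?thesis
    using CK unfolding cuntz_krieger_family_def partial_isometry_def
    by (simp add: 1 2 3 4)
qed

lemma (in cstar_algebra) cuntz_krieger_unit:
  assumes "wf_digraph E" "graph_cstar_algebra E A P S" "finite (verts E)" "x \<in> carrier A"
  defines "e \<equiv> \<Oplus>v\<in>verts E. P v"
  shows "e \<in> carrier A" "e \<otimes> x = x" "x \<otimes> e = x"
  \<comment> \<open>\<open>e\<close> acts as a unit on the generators, and the elements on which it does so form a C*-subalgebra.\<close>
proof -
  interpret wf_digraph E by fact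
  have CK: "cuntz_krieger_family E A P S"
    and gen: "\<And>B. \<lbrakk>cstar_subalgebra B A; P ` verts E \<subseteq> B; S ` arcs E \<subseteq> B\<rbrakk> \<Longrightarrow> B = carrier A"
    using assms(2) by (simp_all add: graph_cstar_algebra_def)
  have Pc: "P v \<in> carrier A" "star A (P v) = P v" "P v \<otimes> P v = P v" if "v \<in> verts E" for v
    using cuntz_krieger_familyD(1)[OF CK that] by (simp_all add: projection_def)
  have P0: "P v \<otimes> P w = \<zero>" if "v \<in> verts E" "w \<in> verts E" "v \<noteq> w" for v w
    using cuntz_krieger_familyD(2)[OF CK that] .
  have Sc: "S f \<in> carrier A" "S f \<otimes> star A (S f) \<otimes> S f = S f"
    "star A (S f) \<otimes> S f = P (head E f)" "P (tail E f) \<otimes> (S f \<otimes> star A (S f)) = S f \<otimes> star A (S f)"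
    if "f \<in> arcs E" for f
    using cuntz_krieger_familyD(3,4,6)[OF CK that] by (simp_all add: partial_isometry_def projection_le_def)
  have PF: "P \<in> verts E \<rightarrow> carrier A" using Pc by blast
  show eA: "e \<in> carrier A" using PF by (simp add: e_def)
  have es: "star A e = e"
    unfolding e_def finsum_star[OF assms(3) PF] using Pc by (intro M.finsum_cong') auto
  have eP: "e \<otimes> P v = P v" if "v \<in> verts E" for v
    unfolding e_def finsum_mult_left[OF assms(3) PF Pc(1)[OF that]]
    using that assms(3) Pc P0 by (intro finsum_single[where i=v]) auto
  have Pe: "P v \<otimes> e = P v" if "v \<in> verts E" for v
    using eP[OF that] star_mult[of e "P v"] es eA Pc that by simp
  have eS: "e \<otimes> S f = S f" if f: "f \<in> arcs E" for f
  proof -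
    have "P (tail E f) \<otimes> S f = P (tail E f) \<otimes> (S f \<otimes> star A (S f)) \<otimes> S f"
      using Sc(1,2)[OF f] Pc(1)[OF tail_in_verts[OF f]] by (simp add: mult_assoc)
    also have "\<dots> = S f" using Sc[OF f] by simp
    finally have "P (tail E f) \<otimes> S f = S f" .
    then show ?thesis
      using eP[OF tail_in_verts[OF f]] eA Sc(1)[OF f] Pc(1)[OF tail_in_verts[OF f]]
        mult_assoc[of e "P (tail E f)" "S f"] by simp
  qed
  have Se: "S f \<otimes> e = S f" if f: "f \<in> arcs E" for f
  proof -
    have "S f \<otimes> P (head E f) = S f"
      using Sc(1,2)[OF f] by (simp add: mult_assoc flip: Sc(3)[OF f])
    then show ?thesis
      using Pe[OF head_in_verts[OF f]] eA Sc(1)[OF f] Pc(1)[OF head_in_verts[OF f]]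
        mult_assoc[of "S f" "P (head E f)" e] by simp
  qed
  have "{x \<in> carrier A. e \<otimes> x = x \<and> x \<otimes> e = x} = carrier A"
    by (rule gen[OF cstar_subalgebra_unit[OF eA es]]) (use eP Pe eS Se Pc(1) Sc(1) in auto)
  then show "e \<otimes> x = x" "x \<otimes> e = x" using assms(4) by blast+
qed

locale unital_graph_algebra = unital_cstar_algebra A + wf_digraph E
  for A :: "'a cstar" (structure) and E :: "('v, 'e) pre_digraph" +
  fixes P :: "'v \<Rightarrow> 'a" and S :: "'e \<Rightarrow> 'a"
  assumes graph: "graph_cstar_algebra E A P S"
    and finite_verts: "finite (verts E)"
    and P_sum: "(\<Oplus>v\<in>verts E. P v) = \<one>"
begin

lemmas CK = graph[unfolded graph_cstar_algebra_def, THEN conjunct2, THEN conjunct1]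

lemma generated: "\<lbrakk>cstar_subalgebra B A; P ` verts E \<subseteq> B; S ` arcs E \<subseteq> B\<rbrakk> \<Longrightarrow> B = carrier A"
  using graph by (simp add: graph_cstar_algebra_def)

lemma P_closed [simp, intro]: "v \<in> verts E \<Longrightarrow> P v \<in> carrier A"
  and star_P [simp]: "v \<in> verts E \<Longrightarrow> star A (P v) = P v"
  and P_idem [simp]: "v \<in> verts E \<Longrightarrow> P v \<otimes> P v = P v"
  and P_orth: "\<lbrakk>v \<in> verts E; w \<in> verts E; v \<noteq> w\<rbrakk> \<Longrightarrow> P v \<otimes> P w = \<zero>"
  using cuntz_krieger_familyD(1,2)[OF CK] by (simp_all add: projection_def)

lemma S_closed [simp, intro]: "e \<in> arcs E \<Longrightarrow> S e \<in> carrier A"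
  and S_star_S: "e \<in> arcs E \<Longrightarrow> star A (S e) \<otimes> S e = P (head E e)"
  and S_star_S_orth: "\<lbrakk>e \<in> arcs E; f \<in> arcs E; e \<noteq> f\<rbrakk> \<Longrightarrow> star A (S e) \<otimes> S f = \<zero>"
  and S_star_S_S: "e \<in> arcs E \<Longrightarrow> S e \<otimes> star A (S e) \<otimes> S e = S e"
  using cuntz_krieger_familyD(3-5)[OF CK] by (simp_all add: partial_isometry_def)

lemma S_P_head: "e \<in> arcs E \<Longrightarrow> S e \<otimes> P (head E e) = S e"
  using S_star_S_S[of e] S_star_S[of e] by (simp add: mult_assoc)

lemma P_tail_S:
  assumes e: "e \<in> arcs E" shows "P (tail E e) \<otimes> S e = S e"
proof -
  have 1: "P (tail E e) \<otimes> (S e \<otimes> star A (S e)) = S e \<otimes> star A (S e)"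
    using cuntz_krieger_familyD(6)[OF CK e] by (simp add: projection_le_def)
  have "P (tail E e) \<otimes> S e = P (tail E e) \<otimes> (S e \<otimes> star A (S e)) \<otimes> S e"
    using e S_star_S_S[OF e] by (simp add: mult_assoc)
  then show ?thesis using 1 S_star_S_S[OF e] by simp
qed

lemma P_S_cases: "\<lbrakk>v \<in> verts E; e \<in> arcs E\<rbrakk> \<Longrightarrow> P v \<otimes> S e = (if v = tail E e then S e else \<zero>)"
  using P_tail_S P_orth[of v "tail E e"] mult_assoc[of "P v" "P (tail E e)" "S e"]
  by (cases "v = tail E e") simp_all

lemma S_P_cases: "\<lbrakk>v \<in> verts E; e \<in> arcs E\<rbrakk> \<Longrightarrow> S e \<otimes> P v = (if v = head E e then S e else \<zero>)"
  using S_P_head P_orth[of "head E e" v] mult_assoc[of "S e" "P (head E e)" "P v"]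
  by (cases "v = head E e") simp_all

lemma star_hom_finsum:
  assumes \<phi>: "\<phi> \<in> star_hom A A" and "finite I" "f \<in> I \<rightarrow> carrier A"
  shows "\<phi> (finsum A f I) = (\<Oplus>i\<in>I. \<phi> (f i))"
  using assms(2,3)
proof (induction I rule: finite_induct)
  case empty
  show ?case using star_homD(4)[OF \<phi>, of \<zero> 0] star_homD(1)[OF \<phi>, of \<zero>] by simp
next
  case (insert i I)
  then have "f \<in> I \<rightarrow> carrier A" "f i \<in> carrier A" by auto
  moreover have "(\<lambda>j. \<phi> (f j)) \<in> I \<rightarrow> carrier A" using calculation star_homD(1)[OF \<phi>] by auto
  ultimately show ?case using insert star_homD(1,2)[OF \<phi>] by simp
qed

lemma star_hom_minus:
  assumes \<phi>: "\<phi> \<in> star_hom A A" and "x \<in> carrier A" "y \<in> carrier A"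
  shows "\<phi> (x \<ominus> y) = \<phi> x \<ominus> \<phi> y"
  using assms star_homD[OF \<phi>] by (simp add: a_minus_def minus_smult)

lemma star_hom_unital:
  assumes \<phi>: "\<phi> \<in> star_hom A A" and "\<And>v. v \<in> verts E \<Longrightarrow> \<phi> (P v) = P v"
  shows "\<phi> \<one> = \<one>"
proof -
  have "\<phi> \<one> = (\<Oplus>v\<in>verts E. \<phi> (P v))"
    unfolding P_sum[symmetric] by (rule star_hom_finsum[OF \<phi> finite_verts]) auto
  also have "\<dots> = (\<Oplus>v\<in>verts E. P v)" using assms(2) by (intro M.finsum_cong') auto
  finally show ?thesis by (simp add: P_sum)
qed

lemma star_hom_contractive:
  assumes \<phi>: "\<phi> \<in> star_hom A A" and "\<And>v. v \<in> verts E \<Longrightarrow> \<phi> (P v) = P v" and "x \<in> carrier A"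
  shows "cnorm A (\<phi> x) \<le> cnorm A x"
  by (rule unital_star_hom_contractive[OF unital_cstar_algebra_axioms \<phi> _ assms(3)])
    (rule star_hom_unital[OF assms(1,2)])

text \<open>Being contractive, two such homomorphisms agree on a closed set, which contains the generators.\<close>

lemma star_hom_determined:
  assumes \<phi>: "\<phi> \<in> star_hom A A" "\<And>v. v \<in> verts E \<Longrightarrow> \<phi> (P v) = P v"
    and \<psi>: "\<psi> \<in> star_hom A A" "\<And>v. v \<in> verts E \<Longrightarrow> \<psi> (P v) = P v"
    and S: "\<And>e. e \<in> arcs E \<Longrightarrow> \<phi> (S e) = \<psi> (S e)"
    and x: "x \<in> carrier A"
  shows "\<phi> x = \<psi> x"
proof -
  let ?B = "{x \<in> carrier A. \<phi> x = \<psi> x}"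
  have cl: "closedin (cstar_topology A) ?B"
  proof (rule closedinI)
    fix x assume x: "x \<in> carrier A" and close: "\<And>\<epsilon>. \<epsilon> > 0 \<Longrightarrow> \<exists>p\<in>?B. cnorm A (x \<ominus> p) < \<epsilon>"
    have "\<phi> x = \<psi> x"
    proof (rule lipschitz_eq_limit[where k=1 and l=1 and L=\<phi> and R=\<psi>, OF x])
      show "\<exists>p\<in>carrier A. cnorm A (x \<ominus> p) < \<epsilon> \<and> \<phi> p = \<psi> p" if "\<epsilon> > 0" for \<epsilon>
        using close[OF that] by blast
      show "cnorm A (\<phi> x \<ominus> \<phi> y) \<le> 1 * cnorm A (x \<ominus> y)" if "y \<in> carrier A" for y
        using star_hom_contractive[OF \<phi>, of "x \<ominus> y"] star_hom_minus[OF \<phi>(1) x that] x that by simp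
      show "cnorm A (\<psi> x \<ominus> \<psi> y) \<le> 1 * cnorm A (x \<ominus> y)" if "y \<in> carrier A" for y
        using star_hom_contractive[OF \<psi>, of "x \<ominus> y"] star_hom_minus[OF \<psi>(1) x that] x that by simp
    qed (use star_homD(1)[OF \<phi>(1)] star_homD(1)[OF \<psi>(1)] in auto)
    then show "x \<in> ?B" using x by simp
  qed auto
  have "\<phi> \<zero> = \<psi> \<zero>"
    using star_hom_finsum[OF \<phi>(1), of "{}"] star_hom_finsum[OF \<psi>(1), of "{}"] by simp
  then have "cstar_subalgebra ?B A"
    using cl star_homD[OF \<phi>(1)] star_homD[OF \<psi>(1)] by (auto simp: cstar_subalgebra_def)
  then have "?B = carrier A"
    by (rule generated) (use \<phi> \<psi> S in auto)
  then show ?thesis using x by blast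
qed

abbreviation gauge :: "complex \<Rightarrow> 'a \<Rightarrow> 'a" where
  "gauge \<equiv> gauge_action E A P S"

text \<open>Universality supplies endomorphisms for \<open>t\<close> and for its conjugate. They are inverse to each other on
the generators, hence everywhere.\<close>

lemma gauge_exists_unique:
  assumes t: "cmod t = 1"
  shows "\<exists>!\<gamma>. \<gamma> \<in> star_aut A \<and> (\<forall>e\<in>arcs E. \<gamma> (S e) = t \<odot> S e) \<and> (\<forall>v\<in>verts E. \<gamma> (P v) = P v)"
proof (rule ex_ex1I)
  have id: "(\<lambda>x. x) \<in> star_hom A A" by (simp add: star_hom_def)
  have ex: "\<exists>\<phi>. \<phi> \<in> star_hom A A \<and> (\<forall>e\<in>arcs E. \<phi> (S e) = t \<odot> S e) \<and> (\<forall>v\<in>verts E. \<phi> (P v) = P v)"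
    if "cmod t = 1" for t
    by (rule graph_cstar_endomorphism[OF wf_digraph_axioms graph cuntz_krieger_gauge[OF CK that]]) blast
  have tt: "cmod (cnj t) = 1" "cnj t * t = 1" "t * cnj t = 1"
    using t complex_norm_square[of t] by (simp_all add: mult.commute)
  obtain \<phi> where \<phi>: "\<phi> \<in> star_hom A A" "\<forall>e\<in>arcs E. \<phi> (S e) = t \<odot> S e" "\<forall>v\<in>verts E. \<phi> (P v) = P v"
    using ex[OF t] by blast
  obtain \<psi> where \<psi>: "\<psi> \<in> star_hom A A" "\<forall>e\<in>arcs E. \<psi> (S e) = cnj t \<odot> S e" "\<forall>v\<in>verts E. \<psi> (P v) = P v"
    using ex[OF tt(1)] by blast
  note \<phi>D = star_homD[OF \<phi>(1)] and \<psi>D = star_homD[OF \<psi>(1)]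
  have comp: "(\<lambda>x. \<phi> (\<psi> x)) \<in> star_hom A A" "(\<lambda>x. \<psi> (\<phi> x)) \<in> star_hom A A"
    using \<phi>D \<psi>D by (auto simp: star_hom_def)
  have inv: "\<phi> (\<psi> x) = x" "\<psi> (\<phi> x) = x" if "x \<in> carrier A" for x
    using star_hom_determined[OF comp(1) _ id _ _ that] star_hom_determined[OF comp(2) _ id _ _ that]
      \<phi> \<psi> tt \<phi>D \<psi>D by (simp_all add: smult_smult)
  have "bij_betw \<phi> (carrier A) (carrier A)"
    by (rule bij_betw_byWitness[where f'=\<psi>]) (use inv \<phi>D(1) \<psi>D(1) in auto)
  moreover have "restrict \<phi> (carrier A) \<in> carrier A \<rightarrow> carrier A" using \<phi>D(1) by auto
  ultimately have "restrict \<phi> (carrier A) \<in> star_aut A"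
    using \<phi>(1) by (simp add: star_aut_def Bij_def star_hom_def)
  then show "\<exists>\<gamma>. \<gamma> \<in> star_aut A \<and> (\<forall>e\<in>arcs E. \<gamma> (S e) = t \<odot> S e) \<and> (\<forall>v\<in>verts E. \<gamma> (P v) = P v)"
    using \<phi>(2,3) by (intro exI[of _ "restrict \<phi> (carrier A)"]) simp
next
  fix \<gamma> \<delta>
  assume \<gamma>: "\<gamma> \<in> star_aut A \<and> (\<forall>e\<in>arcs E. \<gamma> (S e) = t \<odot> S e) \<and> (\<forall>v\<in>verts E. \<gamma> (P v) = P v)"
    and \<delta>: "\<delta> \<in> star_aut A \<and> (\<forall>e\<in>arcs E. \<delta> (S e) = t \<odot> S e) \<and> (\<forall>v\<in>verts E. \<delta> (P v) = P v)"
  then have "\<gamma> \<in> extensional (carrier A)" "\<delta> \<in> extensional (carrier A)"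
    and "\<gamma> \<in> star_hom A A" "\<delta> \<in> star_hom A A"
    by (auto simp: star_aut_def Bij_def)
  moreover have "\<gamma> x = \<delta> x" if "x \<in> carrier A" for x
    using star_hom_determined[OF \<open>\<gamma> \<in> star_hom A A\<close> _ \<open>\<delta> \<in> star_hom A A\<close> _ _ that] \<gamma> \<delta> by simp
  ultimately show "\<gamma> = \<delta>" using extensionalityI[of \<gamma> "carrier A" \<delta>] by blast
qed

context
  fixes t :: complex assumes t: "cmod t = 1"
begin

lemma gauge_hom: "gauge t \<in> star_hom A A"
  and gauge_S: "e \<in> arcs E \<Longrightarrow> gauge t (S e) = t \<odot> S e"
  and gauge_P: "v \<in> verts E \<Longrightarrow> gauge t (P v) = P v"
  using theI'[OF gauge_exists_unique[OF t]] by (auto simp: gauge_action_def star_aut_def)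

lemmas gauge_closed = star_homD(1)[OF gauge_hom]
  and gauge_add = star_homD(2)[OF gauge_hom]
  and gauge_mult = star_homD(3)[OF gauge_hom]
  and gauge_smult = star_homD(4)[OF gauge_hom]
  and gauge_star = star_homD(5)[OF gauge_hom]
  and gauge_minus = star_hom_minus[OF gauge_hom]
  and gauge_one = star_hom_unital[OF gauge_hom gauge_P]
  and gauge_contractive = star_hom_contractive[OF gauge_hom gauge_P]

end

lemma gauge_gauge:
  assumes s: "cmod s = 1" and t: "cmod t = 1" and x: "x \<in> carrier A"
  shows "gauge s (gauge t x) = gauge (s * t) x"
proof -
  have st: "cmod (s * t) = 1" using s t by (simp add: norm_mult)
  have "(\<lambda>x. gauge s (gauge t x)) \<in> star_hom A A"
    using star_homD[OF gauge_hom[OF s]] star_homD[OF gauge_hom[OF t]] by (auto simp: star_hom_def)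
  then show ?thesis
    using s t x star_hom_determined[OF _ _ gauge_hom[OF st]]
    by (simp add: st gauge_P gauge_S gauge_smult smult_smult mult.commute)
qed

lemma core_iff: "x \<in> core E A P S \<longleftrightarrow> x \<in> carrier A \<and> (\<forall>t. cmod t = 1 \<longrightarrow> gauge t x = x)"
  by (simp add: core_def)

end

section \<open>Linear spans\<close>

context cstar_algebra
begin

inductive_set lin_span :: "'a set \<Rightarrow> 'a set" for G :: "'a set" where
  zero: "\<zero> \<in> lin_span G"
| base: "x \<in> G \<Longrightarrow> x \<in> lin_span G"
| add: "\<lbrakk>x \<in> lin_span G; y \<in> lin_span G\<rbrakk> \<Longrightarrow> x \<oplus> y \<in> lin_span G"
| smult: "x \<in> lin_span G \<Longrightarrow> c \<odot> x \<in> lin_span G"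

lemma lin_span_closed:
  assumes "G \<subseteq> carrier A" shows "lin_span G \<subseteq> carrier A"
proof
  fix x assume "x \<in> lin_span G"
  then show "x \<in> carrier A" by induction (use assms in auto)
qed

lemma lin_span_mono:
  assumes "G \<subseteq> lin_span Y" shows "lin_span G \<subseteq> lin_span Y"
proof
  fix x assume "x \<in> lin_span G"
  then show "x \<in> lin_span Y" by induction (use assms in \<open>auto intro: lin_span.intros\<close>)
qed

lemma lin_span_finsum:
  assumes "finite I" "G \<subseteq> carrier A" "\<And>i. i \<in> I \<Longrightarrow> f i \<in> lin_span G"
  shows "finsum A f I \<in> lin_span G"
  using assms(1,3)
proof (induction I rule: finite_induct)
  case empty show ?case by (simp add: lin_span.zero)
next
  case (insert i I)
  have "f j \<in> carrier A" if "j \<in> insert i I" for j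
    using insert.prems[OF that] lin_span_closed[OF assms(2)] by blast
  then have "f \<in> I \<rightarrow> carrier A" "f i \<in> carrier A" by auto
  then show ?case using insert by (simp add: lin_span.add)
qed

lemma lin_span_mult:
  assumes G: "G \<subseteq> carrier A" and Y: "Y \<subseteq> carrier A"
    and GY: "\<And>x y. \<lbrakk>x \<in> G; y \<in> Y\<rbrakk> \<Longrightarrow> x \<otimes> y \<in> lin_span Z"
    and x: "x \<in> lin_span G" and y: "y \<in> lin_span Y"
  shows "x \<otimes> y \<in> lin_span Z"
proof -
  have 1: "x \<otimes> y \<in> lin_span Z" if "x \<in> G" for x
    using y
  proof induction
    case zero then show ?case using that G by (simp add: subset_iff lin_span.zero)
  next
    case (base y) then show ?case using GY that by simp
  next
    case (add y z)
    then have "y \<in> carrier A" "z \<in> carrier A" "x \<in> carrier A"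
      using lin_span_closed[OF Y] that G by auto
    then show ?case using add by (simp add: mult_add_right lin_span.add)
  next
    case (smult y c)
    then have "y \<in> carrier A" "x \<in> carrier A" using lin_span_closed[OF Y] that G by auto
    then show ?case using smult by (simp add: smult_mult_right lin_span.smult)
  qed
  have yA: "y \<in> carrier A" using y lin_span_closed[OF Y] by blast
  show ?thesis using x
  proof induction
    case zero then show ?case using yA by (simp add: lin_span.zero)
  next
    case (base x) then show ?case using 1 by simp
  next
    case (add x z)
    then have "x \<in> carrier A" "z \<in> carrier A" using lin_span_closed[OF G] by auto
    then show ?case using add yA by (simp add: mult_add_left lin_span.add)
  next
    case (smult x c)
    then have "x \<in> carrier A" using lin_span_closed[OF G] by auto
    then show ?case using smult yA by (simp add: smult_mult_left lin_span.smult)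
  qed
qed

lemma lin_span_star:
  assumes G: "G \<subseteq> carrier A" and GY: "\<And>x. x \<in> G \<Longrightarrow> star A x \<in> lin_span Y"
    and x: "x \<in> lin_span G"
  shows "star A x \<in> lin_span Y"
  using x
proof induction
  case (add x y)
  then have "x \<in> carrier A" "y \<in> carrier A" using lin_span_closed[OF G] by auto
  then show ?case using add by (simp add: star_add lin_span.add)
next
  case (smult x c)
  then have "x \<in> carrier A" using lin_span_closed[OF G] by auto
  then show ?case using smult by (simp add: star_smult lin_span.smult)
qed (use GY in \<open>auto intro: lin_span.intros\<close>)

end

section \<open>Monomials and their degrees\<close>

context unital_graph_algebra
begin

text \<open>Ending each word with a vertex projection turns the empty word into that projection and makes
  every word that is not a path to \<open>v\<close> vanish, so that arbitrary edge lists can stand in for paths.\<close>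

definition word_P :: "'e list \<Rightarrow> 'v \<Rightarrow> 'a" where
  "word_P \<alpha> v = foldr (\<lambda>e x. S e \<otimes> x) \<alpha> (P v)"

text \<open>The familiar spanning elements \<open>S\<^sub>\<mu> S\<^sub>\<nu>\<^sup>*\<close> of a graph algebra.\<close>

definition monomial :: "'e list \<Rightarrow> 'v \<Rightarrow> 'e list \<Rightarrow> 'a" where
  "monomial \<mu> v \<nu> = word_P \<mu> v \<otimes> star A (word_P \<nu> v)"

lemma word_P_Nil [simp]: "word_P [] v = P v"
  and word_P_Cons [simp]: "word_P (e # \<alpha>) v = S e \<otimes> word_P \<alpha> v"
  by (simp_all add: word_P_def)

lemma word_P_closed [simp, intro]:
  "\<lbrakk>set \<alpha> \<subseteq> arcs E; v \<in> verts E\<rbrakk> \<Longrightarrow> word_P \<alpha> v \<in> carrier A"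
  by (induction \<alpha>) auto

lemma monomial_closed [simp, intro]:
  "\<lbrakk>set \<mu> \<subseteq> arcs E; set \<nu> \<subseteq> arcs E; v \<in> verts E\<rbrakk> \<Longrightarrow> monomial \<mu> v \<nu> \<in> carrier A"
  by (simp add: monomial_def)

lemma star_monomial:
  "\<lbrakk>set \<mu> \<subseteq> arcs E; set \<nu> \<subseteq> arcs E; v \<in> verts E\<rbrakk> \<Longrightarrow> star A (monomial \<mu> v \<nu>) = monomial \<nu> v \<mu>"
  by (simp add: monomial_def star_mult)

lemma P_word_P_cases:
  assumes "set \<alpha> \<subseteq> arcs E" "v \<in> verts E" "w \<in> verts E"
  shows "P v \<otimes> word_P \<alpha> w = \<zero> \<or> P v \<otimes> word_P \<alpha> w = word_P \<alpha> w"
proof (cases \<alpha>)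
  case Nil
  then show ?thesis using assms P_orth[of v w] by (cases "v = w") auto
next
  case (Cons e \<beta>)
  then have "P v \<otimes> word_P \<alpha> w = (P v \<otimes> S e) \<otimes> word_P \<beta> w"
    using assms by (simp add: mult_assoc)
  then show ?thesis using assms Cons P_S_cases[of v e] by auto
qed

text \<open>Cancelling \<open>S\<^sub>e\<^sup>* S\<^sub>e\<close> from the middle leaves the remainder of the longer word if one word is a
  prefix of the other, and \<open>S\<^sub>e\<^sup>* S\<^sub>f = 0\<close> kills the product otherwise.\<close>

lemma star_word_P_word_P_cases:
  assumes "set \<nu> \<subseteq> arcs E" "set \<alpha> \<subseteq> arcs E" "v \<in> verts E" "w \<in> verts E"
  shows "star A (word_P \<nu> v) \<otimes> word_P \<alpha> w = \<zero>
    \<or> (\<exists>\<alpha>'. \<alpha> = \<nu> @ \<alpha>' \<and> star A (word_P \<nu> v) \<otimes> word_P \<alpha> w = word_P \<alpha>' w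
          \<and> P v \<otimes> word_P \<alpha>' w = word_P \<alpha>' w)
    \<or> (\<exists>\<nu>'. \<nu> = \<alpha> @ \<nu>' \<and> star A (word_P \<nu> v) \<otimes> word_P \<alpha> w = star A (word_P \<nu>' v)
          \<and> P w \<otimes> word_P \<nu>' v = word_P \<nu>' v)"
  using assms
proof (induction \<nu> arbitrary: \<alpha>)
  case Nil
  then show ?case using P_word_P_cases[of \<alpha> v w] by auto
next
  case (Cons e \<nu>)
  show ?case
  proof (cases \<alpha>)
    case Nil
    have "star A (word_P (e # \<nu>) v) \<otimes> P w = star A (P w \<otimes> word_P (e # \<nu>) v)"
      using Cons.prems by (simp add: star_mult)
    then show ?thesis using P_word_P_cases[of "e # \<nu>" w v] Cons.prems Nil by auto
  next
    case (Cons f \<beta>)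
    have mem: "e \<in> arcs E" "f \<in> arcs E" "set \<nu> \<subseteq> arcs E" "set \<beta> \<subseteq> arcs E" "head E e \<in> verts E"
      using Cons.prems Cons by auto
    have eq: "star A (word_P (e # \<nu>) v) \<otimes> word_P \<alpha> w
        = star A (word_P \<nu> v) \<otimes> ((star A (S e) \<otimes> S f) \<otimes> word_P \<beta> w)"
      using Cons.prems Cons mem by (simp add: star_mult mult_assoc)
    show ?thesis
    proof (cases "e = f")
      case False
      then show ?thesis using eq S_star_S_orth[of e f] mem Cons.prems by simp
    next
      case True
      then have "star A (word_P (e # \<nu>) v) \<otimes> word_P \<alpha> w
          = star A (word_P \<nu> v) \<otimes> (P (head E e) \<otimes> word_P \<beta> w)"
        using eq S_star_S mem by simp
      then have "star A (word_P (e # \<nu>) v) \<otimes> word_P \<alpha> w = \<zero> \<or>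
          star A (word_P (e # \<nu>) v) \<otimes> word_P \<alpha> w = star A (word_P \<nu> v) \<otimes> word_P \<beta> w"
        using P_word_P_cases[of \<beta> "head E e" w] mem Cons.prems by auto
      then show ?thesis
        using Cons.IH[of \<beta>] mem Cons.prems True \<open>\<alpha> = f # \<beta>\<close> by auto
    qed
  qed
qed

lemma word_P_mult_word_P:
  assumes "set \<mu> \<subseteq> arcs E" "set \<alpha> \<subseteq> arcs E" "v \<in> verts E" "w \<in> verts E"
    and "P v \<otimes> word_P \<alpha> w = word_P \<alpha> w"
  shows "word_P \<mu> v \<otimes> word_P \<alpha> w = word_P (\<mu> @ \<alpha>) w"
  using assms by (induction \<mu>) (auto simp: mult_assoc)

text \<open>Unless the product vanishes, one of the two middle words is absorbed by the other. Hence degrees add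
up, and in degree 0 the words of the product are not longer than those of the factors; the second
point yields finite-dimensional algebras.\<close>

lemma monomial_mult_cases:
  assumes "set \<mu> \<subseteq> arcs E" "set \<nu> \<subseteq> arcs E" "set \<alpha> \<subseteq> arcs E" "set \<beta> \<subseteq> arcs E"
    "v \<in> verts E" "w \<in> verts E"
  shows "monomial \<mu> v \<nu> \<otimes> monomial \<alpha> w \<beta> = \<zero>
    \<or> (\<exists>\<alpha>'. \<alpha> = \<nu> @ \<alpha>' \<and> monomial \<mu> v \<nu> \<otimes> monomial \<alpha> w \<beta> = monomial (\<mu> @ \<alpha>') w \<beta>)
    \<or> (\<exists>\<nu>'. \<nu> = \<alpha> @ \<nu>' \<and> monomial \<mu> v \<nu> \<otimes> monomial \<alpha> w \<beta> = monomial \<mu> v (\<beta> @ \<nu>'))"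
proof -
  let ?m = "star A (word_P \<nu> v) \<otimes> word_P \<alpha> w"
  have eq: "monomial \<mu> v \<nu> \<otimes> monomial \<alpha> w \<beta> = word_P \<mu> v \<otimes> ?m \<otimes> star A (word_P \<beta> w)"
    using assms by (simp add: monomial_def mult_assoc)
  consider (z) "?m = \<zero>"
    | (l) \<alpha>' where "\<alpha> = \<nu> @ \<alpha>'" "?m = word_P \<alpha>' w" "P v \<otimes> word_P \<alpha>' w = word_P \<alpha>' w"
    | (r) \<nu>' where "\<nu> = \<alpha> @ \<nu>'" "?m = star A (word_P \<nu>' v)" "P w \<otimes> word_P \<nu>' v = word_P \<nu>' v"
    using star_word_P_word_P_cases[of \<nu> \<alpha> v w] assms by blast
  then show ?thesis
  proof cases
    case z then show ?thesis using eq assms by simp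
  next
    case l
    then have "word_P \<mu> v \<otimes> ?m = word_P (\<mu> @ \<alpha>') w"
      using assms word_P_mult_word_P[of \<mu> \<alpha>' v w] by simp
    then have "monomial \<mu> v \<nu> \<otimes> monomial \<alpha> w \<beta> = monomial (\<mu> @ \<alpha>') w \<beta>"
      using eq by (simp add: monomial_def)
    then show ?thesis using l by blast
  next
    case r
    then have "?m \<otimes> star A (word_P \<beta> w) = star A (word_P (\<beta> @ \<nu>') v)"
      using assms word_P_mult_word_P[of \<beta> \<nu>' w v] star_mult[of "word_P \<beta> w" "word_P \<nu>' v"] by simp
    then have "monomial \<mu> v \<nu> \<otimes> monomial \<alpha> w \<beta> = monomial \<mu> v (\<beta> @ \<nu>')"
      using eq assms by (simp add: monomial_def mult_assoc)
    then show ?thesis using r by blast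
  qed
qed

definition monomials :: "int \<Rightarrow> 'a set" where
  "monomials d = {monomial \<mu> v \<nu> | \<mu> v \<nu>. set \<mu> \<subseteq> arcs E \<and> set \<nu> \<subseteq> arcs E \<and> v \<in> verts E
     \<and> int (length \<mu>) - int (length \<nu>) = d}"

abbreviation homogeneous :: "int \<Rightarrow> 'a set" where
  "homogeneous d \<equiv> lin_span (monomials d)"

abbreviation polynomials :: "'a set" where
  "polynomials \<equiv> lin_span (\<Union>d. monomials d)"

lemma monomials_closed: "monomials d \<subseteq> carrier A"
  by (auto simp: monomials_def)

lemma homogeneous_closed: "x \<in> homogeneous d \<Longrightarrow> x \<in> carrier A"
  using lin_span_closed[OF monomials_closed] by blast

lemma polynomials_closed: "x \<in> polynomials \<Longrightarrow> x \<in> carrier A"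
  using lin_span_closed[of "\<Union>d. monomials d"] monomials_closed by blast

lemma monomials_mult:
  assumes "x \<in> monomials c" "y \<in> monomials d"
  shows "x \<otimes> y \<in> homogeneous (c + d)"
proof -
  obtain \<mu> v \<nu> where x: "x = monomial \<mu> v \<nu>" "set \<mu> \<subseteq> arcs E" "set \<nu> \<subseteq> arcs E" "v \<in> verts E"
    "int (length \<mu>) - int (length \<nu>) = c" using assms(1) by (auto simp: monomials_def)
  obtain \<alpha> w \<beta> where y: "y = monomial \<alpha> w \<beta>" "set \<alpha> \<subseteq> arcs E" "set \<beta> \<subseteq> arcs E" "w \<in> verts E"
    "int (length \<alpha>) - int (length \<beta>) = d" using assms(2) by (auto simp: monomials_def)
  consider "x \<otimes> y = \<zero>"
    | \<alpha>' where "\<alpha> = \<nu> @ \<alpha>'" "x \<otimes> y = monomial (\<mu> @ \<alpha>') w \<beta>"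
    | \<nu>' where "\<nu> = \<alpha> @ \<nu>'" "x \<otimes> y = monomial \<mu> v (\<beta> @ \<nu>')"
    using monomial_mult_cases[of \<mu> \<nu> \<alpha> \<beta> v w] x y by blast
  then show ?thesis
  proof cases
    case 1 then show ?thesis by (simp add: lin_span.zero)
  next
    case 2
    then have "x \<otimes> y \<in> monomials (c + d)" using x y unfolding monomials_def by fastforce
    then show ?thesis by (rule lin_span.base)
  next
    case 3
    then have "x \<otimes> y \<in> monomials (c + d)" using x y unfolding monomials_def by fastforce
    then show ?thesis by (rule lin_span.base)
  qed
qed

lemma homogeneous_mult:
  "\<lbrakk>x \<in> homogeneous c; y \<in> homogeneous d\<rbrakk> \<Longrightarrow> x \<otimes> y \<in> homogeneous (c + d)"
  by (rule lin_span_mult[OF monomials_closed monomials_closed monomials_mult])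

lemma monomials_star: "x \<in> monomials d \<Longrightarrow> star A x \<in> monomials (- d)"
  unfolding monomials_def using star_monomial by fastforce

lemma homogeneous_star: "x \<in> homogeneous d \<Longrightarrow> star A x \<in> homogeneous (- d)"
  by (rule lin_span_star[OF monomials_closed]) (auto intro: lin_span.base monomials_star)

lemma P_homogeneous: "v \<in> verts E \<Longrightarrow> P v \<in> homogeneous 0"
  by (rule lin_span.base) (auto simp: monomials_def monomial_def intro!: exI[of _ "[]"] exI[of _ v])

lemma S_homogeneous:
  assumes "e \<in> arcs E" shows "S e \<in> homogeneous 1"
proof (rule lin_span.base)
  have "S e = monomial [e] (head E e) []"
    using assms by (simp add: monomial_def S_P_head mult_assoc)
  moreover have "monomial [e] (head E e) [] \<in> monomials 1"
    unfolding monomials_def using assms by fastforce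
  ultimately show "S e \<in> monomials 1" by simp
qed

lemma one_homogeneous: "\<one> \<in> homogeneous 0"
  unfolding P_sum[symmetric]
  by (rule lin_span_finsum[OF finite_verts monomials_closed]) (rule P_homogeneous)

lemma homogeneous_subset_polynomials: "homogeneous d \<subseteq> polynomials"
  by (rule lin_span_mono) (auto intro: lin_span.base)

lemma polynomials_dense:
  assumes x: "x \<in> carrier A" and "\<epsilon> > 0"
  obtains p where "p \<in> polynomials" "cnorm A (x \<ominus> p) < \<epsilon>"
proof -
  let ?B = "{x \<in> carrier A. \<forall>\<epsilon>>0. \<exists>p\<in>polynomials. cnorm A (x \<ominus> p) < \<epsilon>}"
  have U: "(\<Union>d. monomials d) \<subseteq> carrier A" using monomials_closed by blast
  have "cstar_subalgebra ?B A"
  proof (rule cstar_subalgebra_closure)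
    show "x \<otimes> y \<in> polynomials" if "x \<in> polynomials" "y \<in> polynomials" for x y
    proof (rule lin_span_mult[OF U U _ that])
      fix x y assume "x \<in> (\<Union>d. monomials d)" "y \<in> (\<Union>d. monomials d)"
      then show "x \<otimes> y \<in> polynomials"
        using monomials_mult homogeneous_subset_polynomials by blast
    qed
    show "star A x \<in> polynomials" if "x \<in> polynomials" for x
      by (rule lin_span_star[OF U _ that]) (auto intro: lin_span.base dest: monomials_star)
  qed (auto intro: lin_span.intros polynomials_closed)
  moreover have "x \<in> ?B" if "x \<in> polynomials" for x
  proof -
    have "cnorm A (x \<ominus> x) = 0"
      using polynomials_closed[OF that] by (simp add: cnorm_eq_0 minus_eq_zero_iff)
    then show ?thesis using that polynomials_closed[OF that] by (auto intro!: bexI[of _ x])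
  qed
  then have "P ` verts E \<subseteq> ?B" "S ` arcs E \<subseteq> ?B"
    using P_homogeneous S_homogeneous homogeneous_subset_polynomials by blast+
  ultimately have "?B = carrier A" by (rule generated)
  then show thesis using assms that by blast
qed

section \<open>Fourier coefficients\<close>

lemma gauge_word_P:
  assumes "cmod t = 1" "set \<alpha> \<subseteq> arcs E" "v \<in> verts E"
  shows "gauge t (word_P \<alpha> v) = t ^ length \<alpha> \<odot> word_P \<alpha> v"
  using assms(2)
proof (induction \<alpha>)
  case Nil then show ?case using assms by (simp add: gauge_P)
next
  case (Cons e \<alpha>)
  then show ?case
    using assms by (simp add: gauge_mult gauge_S smult_mult_left smult_mult_right smult_smult mult.commute)
qed

lemma gauge_homogeneous:
  assumes t: "cmod t = 1" and x: "x \<in> homogeneous d"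
  shows "gauge t x = (t powi d) \<odot> x"
  using x
proof induction
  case zero
  show ?case using gauge_smult[OF t, of \<zero> 0] gauge_closed[OF t, of \<zero>] by simp
next
  case (base x)
  then obtain \<mu> v \<nu> where x: "x = monomial \<mu> v \<nu>" "set \<mu> \<subseteq> arcs E" "set \<nu> \<subseteq> arcs E" "v \<in> verts E"
    "d = int (length \<mu>) - int (length \<nu>)" by (auto simp: monomials_def)
  have "t * cnj t = 1" using t complex_norm_square[of t] by simp
  then have t0: "t \<noteq> 0" "cnj t = inverse t" using inverse_unique[of t "cnj t"] by auto
  have "gauge t x = (t ^ length \<mu> * cnj t ^ length \<nu>) \<odot> x"
    using x t
    by (simp add: monomial_def gauge_mult gauge_star gauge_word_P star_smult smult_mult_left
        smult_mult_right smult_smult mult.commute)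
  also have "t ^ length \<mu> * cnj t ^ length \<nu> = t powi d"
    using t0 by (simp add: x(5) power_int_diff power_inverse divide_inverse)
  finally show ?case .
next
  case (add x y)
  then show ?case using homogeneous_closed t by (simp add: gauge_add smult_add_right)
next
  case (smult x c)
  then show ?case using homogeneous_closed t by (simp add: gauge_smult smult_smult mult.commute)
qed

end

lemma norm_cis_power [simp]: "cmod (cis a ^ i) = 1"
  by (simp add: norm_power)

lemma sum_root_of_unity_powers:
  fixes k :: int and N :: nat
  assumes "k \<noteq> 0" "\<bar>k\<bar> < int N"
  shows "(\<Sum>i<N. (cis (2 * pi / N) powi k) ^ i) = 0"
proof -
  define z where "z = cis (2 * pi / N) powi k"
  have z: "z = cis (of_int k * (2 * pi / N))" by (simp add: z_def cis_power_int)
  have N: "N > 0" using assms by simp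
  have "z ^ N = cis (2 * pi * of_int k)" unfolding z DeMoivre using N by (simp add: field_simps)
  then have zN: "z ^ N = 1" by simp
  have "z \<noteq> 1"
  proof
    assume "z = 1"
    then have "cos (of_int k * (2 * pi / N)) = 1" by (simp add: z complex_eq_iff)
    then obtain n :: int where "of_int k * (2 * pi / N) = of_int n * 2 * pi"
      by (auto simp: cos_one_2pi_int)
    then have "real_of_int k = of_int (n * int N)" using N by (simp add: field_simps)
    then have "k = n * int N" by linarith
    then have "int N dvd k" by simp
    then show False using assms zdvd_imp_le[of "int N" "\<bar>k\<bar>"] by simp
  qed
  then show ?thesis using zN by (simp add: z_def[symmetric] geometric_sum)
qed

text \<open>Exponents are taken from the balanced range \<open>-d..d\<close>, since degrees of polynomials are integers of
either sign.\<close>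

lemma root_of_unity_balanced_power:
  fixes z :: complex and d :: nat
  assumes "z ^ (2 * d + 1) = 1"
  obtains j :: int where "\<bar>j\<bar> \<le> int d" "z = cis (2 * pi / (2 * d + 1)) powi j"
proof -
  define N where "N = 2 * d + 1"
  have "bij_betw (\<lambda>k. cis (2 * pi * real k / real N)) {..<N} {z. z ^ N = 1}"
    by (rule bij_betw_roots_unity) (simp add: N_def)
  then have "z \<in> (\<lambda>k. cis (2 * pi * real k / real N)) ` {..<N}"
    using assms by (simp add: bij_betw_def N_def)
  then obtain k where k: "k < N" "z = cis (2 * pi * real k / real N)" by auto
  define j where "j = (if k \<le> d then int k else int k - int N)"
  have "z = cis (of_int j * (2 * pi / real N))"
  proof (cases "k \<le> d")
    case True
    then show ?thesis by (simp add: k j_def mult_ac)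
  next
    case False
    have "of_int j * (2 * pi / real N) + 2 * pi = 2 * pi * real k / real N"
      using False by (simp add: j_def N_def field_simps)
    then show ?thesis unfolding k(2) by (metis cis_mult cis_2pi mult.right_neutral)
  qed
  then show thesis using that[of j] k(1) by (simp add: cis_power_int j_def N_def split: if_splits)
qed

context unital_graph_algebra
begin

text \<open>A discrete Fourier coefficient for the gauge action: an average over the \<open>N\<close>-th roots of unity in
  place of an integral over the circle. It isolates degree \<open>j\<close> among degrees that differ from \<open>j\<close> by
  less than \<open>N\<close>.\<close>

definition fourier :: "nat \<Rightarrow> int \<Rightarrow> 'a \<Rightarrow> 'a" where
  "fourier N j x = complex_of_real (1 / N) \<odot>
     (\<Oplus>i\<in>{..<N}. (cis (2 * pi / N) powi (- j)) ^ i \<odot> gauge (cis (2 * pi / N) ^ i) x)"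

lemma fourier_closed [simp, intro]: "x \<in> carrier A \<Longrightarrow> fourier N j x \<in> carrier A"
  by (auto simp: fourier_def gauge_closed intro!: M.finsum_closed smult_closed')

lemma fourier_add:
  assumes "x \<in> carrier A" "y \<in> carrier A"
  shows "fourier N j (x \<oplus> y) = fourier N j x \<oplus> fourier N j y"
proof -
  let ?f = "\<lambda>x i. (cis (2 * pi / N) powi (- j)) ^ i \<odot> gauge (cis (2 * pi / N) ^ i) x"
  have f: "?f x \<in> {..<N} \<rightarrow> carrier A" "?f y \<in> {..<N} \<rightarrow> carrier A"
    using assms by (auto simp: gauge_closed)
  have "finsum A (?f (x \<oplus> y)) {..<N} = finsum A (\<lambda>i. ?f x i \<oplus> ?f y i) {..<N}"
    using assms f by (intro M.finsum_cong') (auto simp: gauge_add gauge_closed smult_add_right)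
  also have "\<dots> = finsum A (?f x) {..<N} \<oplus> finsum A (?f y) {..<N}"
    by (rule M.finsum_addf[OF f])
  finally show ?thesis
    using f by (simp add: fourier_def smult_add_right)
qed

lemma fourier_eigen:
  assumes x: "x \<in> carrier A" and "\<And>i. i < N \<Longrightarrow> gauge (cis (2 * pi / N) ^ i) x = z ^ i \<odot> x"
  shows "fourier N j x = (1 / of_nat N * (\<Sum>i<N. (cis (2 * pi / N) powi (- j) * z) ^ i)) \<odot> x"
proof -
  have "(\<Oplus>i\<in>{..<N}. (cis (2 * pi / N) powi (- j)) ^ i \<odot> gauge (cis (2 * pi / N) ^ i) x)
      = (\<Oplus>i\<in>{..<N}. (cis (2 * pi / N) powi (- j) * z) ^ i \<odot> x)"
    using assms by (intro M.finsum_cong') (auto simp: smult_smult power_mult_distrib)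
  then show ?thesis using x by (simp add: fourier_def finsum_smult_const smult_smult)
qed

lemma fourier_smult:
  assumes x: "x \<in> carrier A"
  shows "fourier N j (c \<odot> x) = c \<odot> fourier N j x"
proof -
  let ?f = "\<lambda>i. (cis (2 * pi / N) powi (- j)) ^ i \<odot> gauge (cis (2 * pi / N) ^ i) x"
  have f: "?f \<in> {..<N} \<rightarrow> carrier A" using x by (auto simp: gauge_closed)
  have "(\<Oplus>i\<in>{..<N}. (cis (2 * pi / N) powi (- j)) ^ i \<odot> gauge (cis (2 * pi / N) ^ i) (c \<odot> x))
      = (\<Oplus>i\<in>{..<N}. c \<odot> ?f i)"
    using x by (intro M.finsum_cong') (auto simp: gauge_smult gauge_closed smult_smult mult.commute)
  also have "\<dots> = c \<odot> finsum A ?f {..<N}" using finsum_smult[OF _ f] by simp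
  finally show ?thesis using f by (simp add: fourier_def smult_smult mult.commute)
qed

lemma fourier_contractive:
  assumes x: "x \<in> carrier A" and N: "N > 0"
  shows "cnorm A (fourier N j x) \<le> cnorm A x"
proof -
  let ?f = "\<lambda>i. (cis (2 * pi / N) powi (- j)) ^ i \<odot> gauge (cis (2 * pi / N) ^ i) x"
  have f: "?f \<in> {..<N} \<rightarrow> carrier A" using x by (auto simp: gauge_closed)
  have "cnorm A (?f i) \<le> cnorm A x" for i
    using x by (simp add: cnorm_smult gauge_closed gauge_contractive norm_power norm_power_int)
  then have "(\<Sum>i<N. cnorm A (?f i)) \<le> N * cnorm A x"
    using sum_bounded_above[of "{..<N}" "\<lambda>i. cnorm A (?f i)" "cnorm A x"] by simp
  then have "cnorm A (finsum A ?f {..<N}) \<le> N * cnorm A x"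
    using finsum_norm_le[OF _ f] by simp
  then show ?thesis
    using N f by (simp add: fourier_def cnorm_smult norm_divide divide_le_eq mult.commute)
qed

text \<open>The degrees occurring in a polynomial lie in some range \<open>-d..d\<close>. Two integers in this range differ by
at most \<open>2 d\<close>, so \<open>2 d + 1\<close> roots of unity tell them apart.\<close>

lemma fourier_polynomial:
  assumes "p \<in> polynomials"
  obtains d0 where "\<And>d j. \<lbrakk>d0 \<le> d; \<bar>j\<bar> \<le> int d\<rbrakk> \<Longrightarrow> fourier (2 * d + 1) j p \<in> homogeneous j"
proof -
  have "\<exists>d0. \<forall>d j. d0 \<le> d \<and> \<bar>j\<bar> \<le> int d \<longrightarrow> fourier (2 * d + 1) j p \<in> homogeneous j"
    using assms
  proof induction
    case zero
    have "fourier N j \<zero> = \<zero>" for N j using fourier_smult[of \<zero> N j 0] by simp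
    then show ?case by (simp add: lin_span.zero)
  next
    case (base x)
    then obtain m where m: "x \<in> monomials m" by blast
    then have x: "x \<in> homogeneous m" by (rule lin_span.base)
    have "fourier (2 * d + 1) j x \<in> homogeneous j" if d: "nat \<bar>m\<bar> \<le> d" "\<bar>j\<bar> \<le> int d" for d j
    proof -
      let ?N = "2 * d + 1"
      let ?w = "cis (2 * pi / ?N)"
      have "gauge (?w ^ i) x = (?w powi m) ^ i \<odot> x" for i
        using gauge_homogeneous[OF _ x, of "?w ^ i"]
        by (simp add: power_int_power power_int_power' mult.commute)
      then have F: "fourier ?N j x = (1 / of_nat ?N * (\<Sum>i<?N. (?w powi (- j) * ?w powi m) ^ i)) \<odot> x"
        by (intro fourier_eigen homogeneous_closed[OF x])
      have pw: "?w powi (- j) * ?w powi m = ?w powi (m - j)"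
        by (simp add: power_int_add[symmetric] add.commute)
      show ?thesis
      proof (cases "m = j")
        case True
        then show ?thesis using F x by (auto simp: intro: lin_span.smult)
      next
        case False
        then have "(\<Sum>i<?N. (?w powi (m - j)) ^ i) = 0"
          using d by (intro sum_root_of_unity_powers) auto
        then have "fourier ?N j x = \<zero>"
          unfolding F pw using homogeneous_closed[OF x] by simp
        then show ?thesis by (simp add: lin_span.zero)
      qed
    qed
    then show ?case by blast
  next
    case (add x y)
    then obtain a b where ab:
      "\<And>d j. a \<le> d \<and> \<bar>j\<bar> \<le> int d \<Longrightarrow> fourier (2 * d + 1) j x \<in> homogeneous j"
      "\<And>d j. b \<le> d \<and> \<bar>j\<bar> \<le> int d \<Longrightarrow> fourier (2 * d + 1) j y \<in> homogeneous j" by blast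
    then show ?case
      using add.hyps polynomials_closed
      by (intro exI[of _ "max a b"]) (auto simp: fourier_add intro!: lin_span.add)
  next
    case (smult x c)
    then show ?case using polynomials_closed by (auto simp: fourier_smult intro!: lin_span.smult)
  qed
  then show thesis using that by blast
qed

text \<open>Take a polynomial \<open>p\<close> close to \<open>u\<close> with degrees in \<open>-d..d\<close>. On the finite cyclic
  group of \<open>(2 d + 1)\<close>-th roots of unity the character \<open>c\<close> is a power \<open>t \<mapsto> t\<^sup>j\<close> with \<open>\<bar>j\<bar> \<le> d\<close>. The
  corresponding Fourier coefficient fixes \<open>u\<close>, maps \<open>p\<close> to a homogeneous element, and is contractive.\<close>

lemma gauge_eigenvector_near_homogeneous:
  assumes u: "u \<in> carrier A" "u \<noteq> \<zero>"
    and c: "\<And>t. cmod t = 1 \<Longrightarrow> gauge t u = c t \<odot> u" and "\<epsilon> > 0"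
  obtains k p where "p \<in> homogeneous k" "cnorm A (u \<ominus> p) < \<epsilon>"
proof -
  obtain p where p: "p \<in> polynomials" "cnorm A (u \<ominus> p) < \<epsilon>"
    using polynomials_dense[OF u(1) \<open>\<epsilon> > 0\<close>] .
  have pA: "p \<in> carrier A" using p polynomials_closed by blast
  obtain d where d: "\<And>j. \<bar>j\<bar> \<le> int d \<Longrightarrow> fourier (2 * d + 1) j p \<in> homogeneous j"
    using fourier_polynomial[OF p(1)] by (metis order_refl)
  define N where "N = 2 * d + 1"
  have N: "N > 0" by (simp add: N_def)
  define w where "w = cis (2 * pi / N)"
  have w: "cmod (w ^ i) = 1" for i by (simp add: w_def)
  have w0: "w \<noteq> 0" by (simp add: w_def)
  have cancel: "a = b" if "a \<odot> u = b \<odot> u" for a b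
  proof -
    have "(a - b) \<odot> u = \<zero>"
      using that u smult_add_left[of u a "- b"] smult_add_left[of u b "- b"] smult_smult[of u "-1" b] by simp
    then have "cmod (a - b) * cnorm A u = 0" using u cnorm_smult[of u "a - b"] by simp
    then show ?thesis using u cnorm_eq_0 by simp
  qed
  have pow: "c (w ^ i) = c w ^ i" for i
  proof (induction i)
    case 0
    have "gauge 1 u = u"
    proof (rule star_hom_determined[where \<psi>="\<lambda>x. x"])
      show "(\<lambda>x. x) \<in> star_hom A A" by (simp add: star_hom_def)
    qed (use u in \<open>auto simp: gauge_hom gauge_P gauge_S\<close>)
    then show ?case using c[of 1] u cancel[of "c 1" 1] by simp
  next
    case (Suc i)
    have "gauge w (gauge (w ^ i) u) = gauge (w ^ Suc i) u"
      using gauge_gauge[of w "w ^ i" u] w[of 1] w u by simp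
    then show ?case
      using c[OF w, of "Suc i"] c[OF w, of i] c[of w] w[of 1] u Suc cancel
      by (auto simp: gauge_smult smult_smult mult.commute)
  qed
  have "w ^ N = 1" unfolding w_def DeMoivre using N by simp
  then have "c w ^ N = 1" using pow[of N] pow[of 0] by simp
  then obtain j :: int where j: "\<bar>j\<bar> \<le> int d" "c w = w powi j"
    unfolding w_def N_def by (rule root_of_unity_balanced_power) (simp add: add.commute)
  have "fourier N j u = (1 / of_nat N * (\<Sum>i<N. (w powi (- j) * c w) ^ i)) \<odot> u"
    using fourier_eigen[OF u(1), of N "c w" j] c[OF w] pow by (simp add: w_def)
  also have "w powi (- j) * c w = 1" using w0 by (simp add: j(2) power_int_minus)
  finally have Fu: "fourier N j u = u" using u N by simp
  have "fourier N j (u \<ominus> p) = u \<ominus> fourier N j p"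
    using u pA by (simp add: a_minus_def minus_smult fourier_add fourier_smult Fu)
  then have "cnorm A (u \<ominus> fourier N j p) < \<epsilon>"
    using fourier_contractive[of "u \<ominus> p" N j] p u pA N by simp
  then show thesis using that d[OF j(1)] unfolding N_def by blast
qed

end

section \<open>Finite-dimensional approximation forces isometries to be unitary\<close>

context cstar_algebra
begin

lemma lin_span_insertE:
  assumes "x \<in> lin_span (insert m G)" "m \<in> carrier A" "G \<subseteq> carrier A"
  obtains a y where "y \<in> lin_span G" "x = a \<odot> m \<oplus> y"
proof -
  have G: "y \<in> carrier A" if "y \<in> lin_span G" for y using lin_span_closed[OF assms(3)] that by blast
  have "\<exists>a y. y \<in> lin_span G \<and> x = a \<odot> m \<oplus> y"
    using assms(1)
  proof induction
    case zero
    then show ?case using assms(2) by (intro exI[of _ 0] exI[of _ \<zero>]) (simp add: lin_span.zero)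
  next
    case (base x)
    show ?case
    proof (cases "x = m")
      case True
      then show ?thesis
        using assms(2) by (intro exI[of _ 1] exI[of _ \<zero>]) (simp add: lin_span.zero)
    next
      case False
      then have "x \<in> lin_span G" using base by (simp add: lin_span.base)
      then show ?thesis using assms(2) G by (intro exI[of _ 0] exI[of _ x]) simp
    qed
  next
    case (add x x')
    then obtain a y a' y' where y: "y \<in> lin_span G" "x = a \<odot> m \<oplus> y" "y' \<in> lin_span G" "x' = a' \<odot> m \<oplus> y'"
      by blast
    then have "x \<oplus> x' = (a + a') \<odot> m \<oplus> (y \<oplus> y')"
      using assms(2) G by (simp add: smult_add_left M.add.m_ac)
    then show ?case using y lin_span.add by blast
  next
    case (smult x c)
    then obtain a y where y: "y \<in> lin_span G" "x = a \<odot> m \<oplus> y" by blast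
    then have "c \<odot> x = (c * a) \<odot> m \<oplus> c \<odot> y"
      using assms(2) G by (simp add: smult_add_right smult_smult)
    then show ?case using y lin_span.smult by blast
  qed
  then show thesis using that by blast
qed

text \<open>Gaussian elimination: a pivot removes one spanning vector \<open>m\<close> and one of the given elements.\<close>

lemma lin_dependent_if_card_less:
  assumes "finite G" "G \<subseteq> carrier A" "finite I" "card G < card I"
    and "\<And>i. i \<in> I \<Longrightarrow> w i \<in> lin_span G"
  shows "\<exists>c. (\<exists>i\<in>I. c i \<noteq> 0) \<and> (\<Oplus>i\<in>I. c i \<odot> w i) = \<zero>"
  using assms
proof (induction G arbitrary: I w rule: finite_induct)
  case empty
  have "x = \<zero>" if "x \<in> lin_span {}" for x using that by induction auto
  then have "w i = \<zero>" if "i \<in> I" for i using empty.prems(4)[OF that] .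
  then have "(\<Oplus>i\<in>I. 1 \<odot> w i) = (\<Oplus>i\<in>I. \<zero>)"
    by (intro M.finsum_cong') auto
  moreover have "I \<noteq> {}" using empty by auto
  ultimately show ?case by (intro exI[of _ "\<lambda>_. 1"]) auto
next
  case (insert m G)
  have m: "m \<in> carrier A" and G: "G \<subseteq> carrier A" using insert.prems by auto
  note cl = lin_span_closed[OF G, THEN subsetD]
  have wA: "w i \<in> carrier A" if "i \<in> I" for i
    using insert.prems(4)[OF that] lin_span_closed[OF insert.prems(1)] by blast
  have "\<forall>i\<in>I. \<exists>a y. y \<in> lin_span G \<and> w i = a \<odot> m \<oplus> y"
    using insert.prems(4) lin_span_insertE[OF _ m G] by metis
  then obtain a y where ay: "\<And>i. i \<in> I \<Longrightarrow> y i \<in> lin_span G" "\<And>i. i \<in> I \<Longrightarrow> w i = a i \<odot> m \<oplus> y i"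
    by metis
  show ?case
  proof (cases "\<forall>i\<in>I. a i = 0")
    case True
    then have "w i \<in> lin_span G" if "i \<in> I" for i using ay[OF that] cl m that by simp
    moreover have "card G < card I" using insert by simp
    ultimately show ?thesis using insert.IH[OF G insert.prems(2), of w] by simp
  next
    case False
    then obtain p where p: "p \<in> I" "a p \<noteq> 0" by blast
    define b where "b i = w i \<oplus> (- (a i / a p)) \<odot> w p" for i
    have bG: "b i \<in> lin_span G" if "i \<in> I" for i
    proof -
      have "b i = (a i \<odot> m \<oplus> y i) \<oplus> ((- a i) \<odot> m \<oplus> (- (a i / a p)) \<odot> y p)"
        using ay that p m cl by (simp add: b_def smult_add_right smult_smult)
      also have "\<dots> = (a i + - a i) \<odot> m \<oplus> (y i \<oplus> (- (a i / a p)) \<odot> y p)"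
        using ay(1) that p m cl by (simp only: smult_add_left) (simp add: M.add.m_ac)
      also have "\<dots> = y i \<oplus> (- (a i / a p)) \<odot> y p" using ay(1) that p m cl by simp
      finally show ?thesis using ay(1) that p by (simp add: lin_span.intros)
    qed
    let ?I = "I - {p}"
    have "card G < card ?I" using insert p by simp
    then obtain c where c: "\<exists>i\<in>?I. c i \<noteq> 0" "(\<Oplus>i\<in>?I. c i \<odot> b i) = \<zero>"
      using insert.IH[OF G, of ?I b] insert.prems(2) bG by auto
    \<comment> \<open>A relation between the reduced elements \<open>b i\<close> becomes one between the \<open>w i\<close> once \<open>w p\<close> receives
      the total amount that was subtracted.\<close>
    define c' where "c' = (\<lambda>i. if i = p then - (\<Sum>i\<in>?I. c i * (a i / a p)) else c i)"
    have bA: "b i \<in> carrier A" if "i \<in> I" for i using bG[OF that] cl by blast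
    have wb: "c i \<odot> w i = c i \<odot> b i \<oplus> (c i * (a i / a p)) \<odot> w p" if "i \<in> I" for i
    proof -
      have "c i \<odot> b i \<oplus> (c i * (a i / a p)) \<odot> w p
          = c i \<odot> w i \<oplus> ((- (c i * (a i / a p)) + c i * (a i / a p)) \<odot> w p)"
        using wA[OF that] wA[OF p(1)]
        by (simp only: smult_add_left) (simp add: b_def smult_add_right smult_smult M.add.m_assoc)
      then show ?thesis using wA[OF that] wA[OF p(1)] by simp
    qed
    have "(\<Oplus>i\<in>?I. c' i \<odot> w i) = (\<Oplus>i\<in>?I. c i \<odot> b i \<oplus> (c i * (a i / a p)) \<odot> w p)"
      using wA bA p wb by (intro M.finsum_cong') (auto simp: c'_def)
    also have "\<dots> = (\<Oplus>i\<in>?I. c i \<odot> b i) \<oplus> (\<Oplus>i\<in>?I. (c i * (a i / a p)) \<odot> w p)"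
      using wA bA p by (intro M.finsum_addf) auto
    also have "\<dots> = (- c' p) \<odot> w p"
      using c(2) wA[OF p(1)] insert.prems(2) by (simp add: finsum_smult_const c'_def)
    finally have rest: "(\<Oplus>i\<in>?I. c' i \<odot> w i) = (- c' p) \<odot> w p" .
    have "(\<Oplus>i\<in>I. c' i \<odot> w i) = (\<Oplus>i\<in>insert p ?I. c' i \<odot> w i)"
      using p by (simp add: insert_absorb)
    also have "\<dots> = c' p \<odot> w p \<oplus> (\<Oplus>i\<in>?I. c' i \<odot> w i)"
      using wA p insert.prems(2) by (intro M.finsum_insert) auto
    also have "\<dots> = (c' p + - c' p) \<odot> w p"
      unfolding rest using wA[OF p(1)] by (simp only: smult_add_left)
    finally have "(\<Oplus>i\<in>I. c' i \<odot> w i) = \<zero>" using wA[OF p(1)] by simp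
    moreover have "\<exists>i\<in>I. c' i \<noteq> 0" using c(1) by (auto simp: c'_def)
    ultimately show ?thesis by blast
  qed
qed

lemma finsum_lessThan_Suc_shift:
  assumes "f \<in> {..<Suc n} \<rightarrow> carrier A"
  shows "finsum A f {..<Suc n} = f 0 \<oplus> (\<Oplus>i\<in>{..<n}. f (Suc i))"
  using assms
proof (induction n)
  case 0
  then show ?case by (simp add: lessThan_Suc)
next
  case (Suc n)
  have "finsum A f {..<Suc (Suc n)} = f (Suc n) \<oplus> finsum A f {..<Suc n}"
    using Suc.prems by (subst lessThan_Suc) (intro M.finsum_insert, auto)
  also have "finsum A f {..<Suc n} = f 0 \<oplus> (\<Oplus>i\<in>{..<n}. f (Suc i))"
    using Suc.prems by (intro Suc.IH) auto
  also have "f (Suc n) \<oplus> (f 0 \<oplus> (\<Oplus>i\<in>{..<n}. f (Suc i))) = f 0 \<oplus> (f (Suc n) \<oplus> (\<Oplus>i\<in>{..<n}. f (Suc i)))"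
    using Suc.prems by (intro M.add.m_lcomm M.finsum_closed) auto
  also have "f (Suc n) \<oplus> (\<Oplus>i\<in>{..<n}. f (Suc i)) = (\<Oplus>i\<in>{..<Suc n}. f (Suc i))"
    using Suc.prems by (subst lessThan_Suc) (intro M.finsum_insert[symmetric], auto)
  finally show ?case .
qed

end

context unital_cstar_algebra
begin

text \<open>A relation with nonzero constant term \<open>c\<^sub>0\<close> reads \<open>c\<^sub>0 1 = - w q\<close>. If the constant term vanishes,
the relation is \<open>w q = 0\<close>, and cancelling \<open>w\<close> leaves the shorter relation \<open>q = 0\<close>.\<close>

lemma right_inverse_if_polynomial_relation:
  fixes n :: nat
  assumes w: "w \<in> carrier A" and cancel: "\<And>x. \<lbrakk>x \<in> carrier A; w \<otimes> x = \<zero>\<rbrakk> \<Longrightarrow> x = \<zero>"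
    and "i < n" "c i \<noteq> 0" "(\<Oplus>i\<in>{..<n}. c i \<odot> w [^] i) = \<zero>"
  shows "\<exists>y\<in>carrier A. w \<otimes> y = \<one>"
  using assms(3-)
proof (induction n arbitrary: c i)
  case 0
  then show ?case by simp
next
  case (Suc n)
  define q where "q = (\<Oplus>i\<in>{..<n}. c (Suc i) \<odot> w [^] i)"
  have q: "q \<in> carrier A" using w by (auto simp: q_def intro!: M.finsum_closed)
  have "(\<Oplus>i\<in>{..<Suc n}. c i \<odot> w [^] i)
      = c 0 \<odot> w [^] (0::nat) \<oplus> (\<Oplus>i\<in>{..<n}. c (Suc i) \<odot> w [^] Suc i)"
    using w by (intro finsum_lessThan_Suc_shift) auto
  also have "(\<Oplus>i\<in>{..<n}. c (Suc i) \<odot> w [^] Suc i) = (\<Oplus>i\<in>{..<n}. w \<otimes> (c (Suc i) \<odot> w [^] i))"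
    using w by (intro M.finsum_cong') (auto simp: smult_mult_right nat_pow_Suc2[symmetric] simp del: nat_pow_Suc)
  also have "\<dots> = w \<otimes> q"
    unfolding q_def using w by (intro finsum_mult_right[symmetric]) auto
  finally have rel: "c 0 \<odot> \<one> \<oplus> w \<otimes> q = \<zero>" using Suc.prems(3) by simp
  show ?case
  proof (cases "c 0 = 0")
    case False
    have "w \<otimes> ((- 1 / c 0) \<odot> q) = (- 1 / c 0) \<odot> (w \<otimes> q)"
      using w q by (simp add: smult_mult_right)
    also have "w \<otimes> q = (- c 0) \<odot> \<one>"
    proof -
      have "\<ominus> (c 0 \<odot> \<one>) = w \<otimes> q"
        using rel w q by (intro M.minus_equality) (auto simp: M.add.m_comm)
      then show ?thesis by (simp add: minus_smult smult_smult)
    qed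
    also have "(- 1 / c 0) \<odot> ((- c 0) \<odot> \<one>) = \<one>" using False by (simp add: smult_smult)
    finally show ?thesis using q by blast
  next
    case True
    then have "q = \<zero>" using rel w q cancel by simp
    moreover obtain i' where "i = Suc i'" using Suc.prems(2) True by (cases i) auto
    ultimately show ?thesis using Suc.IH[of i' "\<lambda>i. c (Suc i)"] Suc.prems by (simp add: q_def)
  qed
qed

lemma left_cancellable_imp_right_invertible:
  assumes G: "finite G" "G \<subseteq> carrier A" "\<And>i. w [^] (i::nat) \<in> lin_span G"
    and w: "w \<in> carrier A" and cancel: "\<And>x. \<lbrakk>x \<in> carrier A; w \<otimes> x = \<zero>\<rbrakk> \<Longrightarrow> x = \<zero>"
  obtains y where "y \<in> carrier A" "w \<otimes> y = \<one>"
proof -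
  obtain c i where ci: "i < Suc (card G)" "c i \<noteq> 0" "(\<Oplus>i\<in>{..<Suc (card G)}. c i \<odot> w [^] i) = \<zero>"
    using lin_dependent_if_card_less[OF G(1,2), of "{..<Suc (card G)}" "\<lambda>i. w [^] i"] G(3) by auto
  have "\<exists>y\<in>carrier A. w \<otimes> y = \<one>"
    by (rule right_inverse_if_polynomial_relation[OF w _ ci]) (rule cancel)
  then show thesis using that by blast
qed

text \<open>Finite-dimensional algebras contain no proper isometries, and this persists under approximation.
Since \<open>g = W\<^sup>* w\<close> is within distance less than 1 of \<open>W\<^sup>* W = 1\<close>, it is left cancellable, and so is \<open>w\<close>.
The powers of \<open>w\<close> span a finite-dimensional space, so \<open>w\<close> has a right inverse \<open>y\<close>. From \<open>W\<^sup>* = g y\<close>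
one computes that \<open>y W\<close> is a two-sided inverse of \<open>g\<close>, whence \<open>W W\<^sup>* = w (y W g) y = 1\<close>.\<close>

lemma isometry_unitary_if_near_algebraic:
  assumes W: "W \<in> carrier A" "star A W \<otimes> W = \<one>" and near: "cnorm A (W \<ominus> w) < 1"
    and w: "w \<in> carrier A" and G: "finite G" "G \<subseteq> carrier A" "\<And>i. w [^] (i::nat) \<in> lin_span G"
  shows "W \<otimes> star A W = \<one>"
proof -
  define g where "g = star A W \<otimes> w"
  have g: "g \<in> carrier A" using W w by (simp add: g_def)
  have gx: "x = \<zero>" if x: "x \<in> carrier A" "g \<otimes> x = \<zero>" for x
  proof (rule ccontr)
    assume "x \<noteq> \<zero>"
    then have pos: "cnorm A x > 0" using cnorm_eq_0[OF x(1)] cnorm_nonneg[OF x(1)] by linarith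
    have "star A W \<otimes> ((W \<ominus> w) \<otimes> x) = (star A W \<otimes> W) \<otimes> x \<ominus> g \<otimes> x"
      using W(1) w x g by (simp add: mult_minus_left mult_minus_right g_def mult_assoc)
    then have "x = star A W \<otimes> ((W \<ominus> w) \<otimes> x)" using W x by (simp add: a_minus_def minus_smult)
    then have "cnorm A x \<le> cnorm A (star A W) * cnorm A ((W \<ominus> w) \<otimes> x)"
      using cnorm_mult[of "star A W" "(W \<ominus> w) \<otimes> x"] W w x by simp
    also have "\<dots> \<le> 1 * (cnorm A (W \<ominus> w) * cnorm A x)"
      using isometry_cnorm_le[OF W] cnorm_mult[of "W \<ominus> w" x] W w x
      by (intro mult_mono) (auto simp: cnorm_nonneg)
    also have "\<dots> < cnorm A x" using near pos by simp
    finally show False by simp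
  qed
  have "x = \<zero>" if "x \<in> carrier A" "w \<otimes> x = \<zero>" for x
    using gx[OF that(1)] that W w by (simp add: g_def mult_assoc)
  then obtain y where y: "y \<in> carrier A" "w \<otimes> y = \<one>"
    using left_cancellable_imp_right_invertible[OF G w] by blast
  have gy: "g \<otimes> y = star A W" using W w y by (simp add: g_def mult_assoc)
  have "g \<otimes> (y \<otimes> W \<otimes> g \<ominus> \<one>) = (g \<otimes> y) \<otimes> W \<otimes> g \<ominus> g"
    using g y W by (simp add: mult_minus_right mult_assoc)
  also have "\<dots> = \<zero>" using gy W g by (simp add: minus_eq_zero_iff)
  finally have "y \<otimes> W \<otimes> g \<ominus> \<one> = \<zero>" using g y W by (intro gx[of "y \<otimes> W \<otimes> g \<ominus> \<one>"]) auto
  then have yWg: "y \<otimes> W \<otimes> g = \<one>" using g y W minus_eq_zero_iff[of "y \<otimes> W \<otimes> g" \<one>] by simp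
  have "W \<otimes> star A W = (w \<otimes> y) \<otimes> W \<otimes> (g \<otimes> y)" using gy y W by simp
  also have "\<dots> = w \<otimes> (y \<otimes> W \<otimes> g) \<otimes> y" using g w y(1) W(1) by (simp add: mult_assoc)
  also have "\<dots> = \<one>" using yWg w y by simp
  finally show ?thesis .
qed

end

context unital_graph_algebra
begin

text \<open>The AF structure of the core, in the form in which the argument uses it: monomials of degree 0
over a finite set of edges with words of bounded length are finite in number and closed under
multiplication up to zero.\<close>

lemma finite_dimensional_homogeneous_0:
  assumes "w \<in> homogeneous 0"
  obtains G where "finite G" "G \<subseteq> carrier A" "\<And>i. w [^] (i::nat) \<in> lin_span G"
proof -
  define B where "B F N = {monomial \<mu> v \<nu> | \<mu> v \<nu>. set \<mu> \<subseteq> F \<and> set \<nu> \<subseteq> F \<and> v \<in> verts E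
     \<and> length \<mu> = length \<nu> \<and> length \<nu> \<le> N}" for F N
  have B_mono: "B F N \<subseteq> B F' N'" if "F \<subseteq> F'" "N \<le> N'" for F F' N N'
    using that unfolding B_def by fastforce
  have B_finite: "finite (B F N)" if "finite F" for F N
  proof (rule finite_subset)
    let ?L = "{xs. set xs \<subseteq> F \<and> length xs \<le> N}"
    show "B F N \<subseteq> (\<lambda>(\<mu>, v, \<nu>). monomial \<mu> v \<nu>) ` (?L \<times> verts E \<times> ?L)"
    proof
      fix x assume "x \<in> B F N"
      then obtain \<mu> v \<nu> where "x = monomial \<mu> v \<nu>" "\<mu> \<in> ?L" "v \<in> verts E" "\<nu> \<in> ?L"
        by (auto simp: B_def)
      then show "x \<in> (\<lambda>(\<mu>, v, \<nu>). monomial \<mu> v \<nu>) ` (?L \<times> verts E \<times> ?L)"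
        by (intro image_eqI[of _ _ "(\<mu>, v, \<nu>)"]) auto
    qed
    show "finite ((\<lambda>(\<mu>, v, \<nu>). monomial \<mu> v \<nu>) ` (?L \<times> verts E \<times> ?L))"
      using finite_lists_length_le[OF that] finite_verts by blast
  qed
  have BA: "B F N \<subseteq> carrier A" if "F \<subseteq> arcs E" for F N
    using that by (fastforce simp: B_def)
  have B_mult: "x \<otimes> y \<in> lin_span (B F N)" if F: "F \<subseteq> arcs E" and x: "x \<in> B F N" and y: "y \<in> B F N"
    for F N x y
  proof -
    obtain \<mu> v \<nu> where x: "x = monomial \<mu> v \<nu>" "set \<mu> \<subseteq> F" "set \<nu> \<subseteq> F" "v \<in> verts E"
      "length \<mu> = length \<nu>" "length \<nu> \<le> N" using x by (auto simp: B_def)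
    obtain \<alpha> w \<beta> where y: "y = monomial \<alpha> w \<beta>" "set \<alpha> \<subseteq> F" "set \<beta> \<subseteq> F" "w \<in> verts E"
      "length \<alpha> = length \<beta>" "length \<beta> \<le> N" using y by (auto simp: B_def)
    consider "x \<otimes> y = \<zero>"
      | \<alpha>' where "\<alpha> = \<nu> @ \<alpha>'" "x \<otimes> y = monomial (\<mu> @ \<alpha>') w \<beta>"
      | \<nu>' where "\<nu> = \<alpha> @ \<nu>'" "x \<otimes> y = monomial \<mu> v (\<beta> @ \<nu>')"
      using monomial_mult_cases[of \<mu> \<nu> \<alpha> \<beta> v w] x y F by blast
    then show ?thesis
    proof cases
      case 1 then show ?thesis by (simp add: lin_span.zero)
    next
      case 2
      then have "x \<otimes> y \<in> B F N" using x y unfolding B_def by fastforce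
      then show ?thesis by (rule lin_span.base)
    next
      case 3
      then have "x \<otimes> y \<in> B F N" using x y unfolding B_def by fastforce
      then show ?thesis by (rule lin_span.base)
    qed
  qed
  have "\<exists>F N. finite F \<and> F \<subseteq> arcs E \<and> w \<in> lin_span (B F N)"
    using assms
  proof induction
    case zero
    show ?case by (intro exI[of _ "{}"] exI[of _ 0]) (simp add: lin_span.zero)
  next
    case (base x)
    then obtain \<mu> v \<nu> where "x = monomial \<mu> v \<nu>" "set \<mu> \<subseteq> arcs E" "set \<nu> \<subseteq> arcs E" "v \<in> verts E"
      "length \<mu> = length \<nu>" by (auto simp: monomials_def)
    then have "x \<in> B (set \<mu> \<union> set \<nu>) (length \<nu>)" "set \<mu> \<union> set \<nu> \<subseteq> arcs E"
      unfolding B_def by fastforce+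
    then show ?case by (intro exI[of _ "set \<mu> \<union> set \<nu>"] exI[of _ "length \<nu>"]) (simp add: lin_span.base)
  next
    case (add x y)
    then obtain F N F' N' where *: "finite F" "F \<subseteq> arcs E" "x \<in> lin_span (B F N)"
      "finite F'" "F' \<subseteq> arcs E" "y \<in> lin_span (B F' N')" by blast
    have "lin_span (B F N) \<subseteq> lin_span (B (F \<union> F') (max N N'))"
      "lin_span (B F' N') \<subseteq> lin_span (B (F \<union> F') (max N N'))"
      using B_mono[of F "F \<union> F'" N "max N N'"] B_mono[of F' "F \<union> F'" N' "max N N'"]
      by (auto intro!: lin_span_mono lin_span.base)
    then show ?case
      using * by (intro exI[of _ "F \<union> F'"] exI[of _ "max N N'"]) (auto intro!: lin_span.add)
  next
    case (smult x c)
    then show ?case using lin_span.smult by blast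
  qed
  then obtain F N where F: "finite F" "F \<subseteq> arcs E" "w \<in> lin_span (B F N)" by blast
  have wi: "w [^] i \<in> lin_span (B F N)" for i :: nat
  proof (induction i)
    case 0
    have "P v \<in> B F N" if "v \<in> verts E" for v
      unfolding B_def using that by (auto simp: monomial_def intro!: exI[of _ "[]"] exI[of _ v])
    then have "(\<Oplus>v\<in>verts E. P v) \<in> lin_span (B F N)"
      by (intro lin_span_finsum[OF finite_verts BA[OF F(2)]] lin_span.base)
    then show ?case by (simp add: P_sum)
  next
    case (Suc i)
    then show ?case
      using lin_span_mult[OF BA[OF F(2)] BA[OF F(2)] B_mult[OF F(2)] Suc F(3)] by simp
  qed
  show thesis using that[OF B_finite[OF F(1)] BA[OF F(2)] wi] .
qed

end

section \<open>The isometry of incoming edges\<close>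

context unital_cstar_algebra
begin

lemma star_nat_pow: "x \<in> carrier A \<Longrightarrow> star A (x [^] (n::nat)) = star A x [^] n"
proof (induction n)
  case (Suc n)
  then show ?case using nat_pow_Suc2[of "star A x" n] by (simp add: star_mult)
qed simp

lemma isometry_nat_pow:
  assumes "w \<in> carrier A" "star A w \<otimes> w = \<one>"
  shows "star A (w [^] (n::nat)) \<otimes> w [^] n = \<one>"
proof (induction n)
  case (Suc n)
  have "star A (w [^] Suc n) \<otimes> w [^] Suc n = star A w \<otimes> (star A (w [^] n) \<otimes> w [^] n) \<otimes> w"
    using assms(1) by (simp add: star_mult mult_assoc)
  then show ?case using Suc assms by simp
qed simp

end

text \<open>A graph without sources admits a choice of one incoming edge at every vertex.\<close>

locale incoming_arcs = unital_graph_algebra A E P S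
  for A :: "'a cstar" (structure) and E :: "('v, 'e) pre_digraph" and P S +
  fixes arc :: "'v \<Rightarrow> 'e"
  assumes arc: "v \<in> verts E \<Longrightarrow> arc v \<in> arcs E"
    and head_arc: "v \<in> verts E \<Longrightarrow> head E (arc v) = v"
begin

text \<open>Distinct edges have orthogonal ranges and every vertex is the head of one chosen edge, so
  \<open>T\<^sup>* T = \<Sum>\<^sub>v P\<^sub>v = 1\<close>: the absence of sources produces an isometry of degree 1.\<close>

definition T :: 'a where
  "T = (\<Oplus>v\<in>verts E. S (arc v))"

lemma S_arc_funcset: "(\<lambda>v. S (arc v)) \<in> verts E \<rightarrow> carrier A"
  using arc by auto

lemma T_closed [simp, intro]: "T \<in> carrier A"
  unfolding T_def using S_arc_funcset by (rule M.finsum_closed)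

lemma T_mult_P: "v \<in> verts E \<Longrightarrow> T \<otimes> P v = S (arc v)"
  unfolding T_def
  by (subst finsum_mult_left[OF finite_verts S_arc_funcset])
    (auto intro!: finsum_single[where i=v] simp: finite_verts S_P_cases arc head_arc)

lemma star_S_mult_T:
  assumes f: "f \<in> arcs E"
  shows "star A (S f) \<otimes> T = (if f \<in> arc ` verts E then P (head E f) else \<zero>)"
proof -
  have eq: "star A (S f) \<otimes> T = (\<Oplus>v\<in>verts E. star A (S f) \<otimes> S (arc v))"
    unfolding T_def using f by (intro finsum_mult_right[OF finite_verts S_arc_funcset]) auto
  show ?thesis
  proof (cases "f \<in> arc ` verts E")
    case True
    then obtain v where v: "v \<in> verts E" "f = arc v" by blast
    have "(\<Oplus>v\<in>verts E. star A (S f) \<otimes> S (arc v)) = P (head E f)"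
    proof (rule finsum_single[where i=v])
      fix w assume "w \<in> verts E" "w \<noteq> v"
      then have "arc w \<noteq> f" using head_arc v by metis
      then show "star A (S f) \<otimes> S (arc w) = \<zero>"
        using S_star_S_orth[OF f, of "arc w"] arc \<open>w \<in> verts E\<close> by simp
    qed (use finite_verts v f S_star_S in auto)
    then show ?thesis using eq True by simp
  next
    case False
    then have "(\<Oplus>v\<in>verts E. star A (S f) \<otimes> S (arc v)) = (\<Oplus>v\<in>verts E. \<zero>)"
      using f arc by (intro M.finsum_cong') (auto intro: S_star_S_orth)
    then show ?thesis using eq False by simp
  qed
qed

lemma T_isometry: "star A T \<otimes> T = \<one>"
proof -
  have "star A T = (\<Oplus>v\<in>verts E. star A (S (arc v)))"
    unfolding T_def by (rule finsum_star[OF finite_verts S_arc_funcset])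
  then have "star A T \<otimes> T = (\<Oplus>v\<in>verts E. star A (S (arc v)) \<otimes> T)"
    using finsum_mult_left[OF finite_verts, of "\<lambda>v. star A (S (arc v))" T] arc by auto
  also have "\<dots> = (\<Oplus>v\<in>verts E. P v)"
    using arc head_arc by (intro M.finsum_cong') (auto simp: star_S_mult_T)
  finally show ?thesis by (simp add: P_sum)
qed

lemma T_homogeneous: "T \<in> homogeneous 1"
  unfolding T_def
  by (rule lin_span_finsum[OF finite_verts monomials_closed]) (use arc S_homogeneous in auto)

lemma T_pow_homogeneous: "T [^] (n::nat) \<in> homogeneous (int n)"
proof (induction n)
  case 0 then show ?case using one_homogeneous by simp
next
  case (Suc n)
  then show ?case using homogeneous_mult[OF Suc T_homogeneous] by (simp add: add.commute)
qed

text \<open>For \<open>u\<close> close to degree \<open>k > 0\<close> the isometry \<open>W = u\<^sup>* T\<^sup>k\<close> is close to \<open>p\<^sup>* T\<^sup>k\<close>, which has degree 0 and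
hence lies in a finite-dimensional algebra. So \<open>W\<close> is unitary, and with it \<open>T\<^sup>k = u W\<close> and \<open>T\<close>.\<close>

lemma T_unitary_if_unitary_near_positive_degree:
  assumes u: "u \<in> carrier A" "star A u \<otimes> u = \<one>" "u \<otimes> star A u = \<one>"
    and p: "p \<in> homogeneous k" and k: "k > 0" and near: "cnorm A (u \<ominus> p) < 1"
  shows "T \<otimes> star A T = \<one>"
proof -
  \<comment> \<open>Writing \<open>k = m + 1\<close> lets one factor \<open>T\<close> split off at the end of the proof.\<close>
  define m where "m = nat k - 1"
  have k_eq: "k = int (Suc m)" using k by (simp add: m_def)
  let ?R = "T [^] Suc m"
  have pA: "p \<in> carrier A" using homogeneous_closed[OF p] .
  have R: "star A ?R \<otimes> ?R = \<one>" "?R \<in> carrier A"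
    using isometry_nat_pow[OF T_closed T_isometry, of "Suc m"] by (simp_all del: nat_pow_Suc)
  define W where "W = star A u \<otimes> ?R"
  define w where "w = star A p \<otimes> ?R"
  have W: "W \<in> carrier A" and w: "w \<in> carrier A" using u R pA unfolding W_def w_def by blast+
  have sW: "star A W = star A ?R \<otimes> u" using u R by (simp add: W_def star_mult del: nat_pow_Suc)
  have "star A W \<otimes> W = star A ?R \<otimes> (u \<otimes> star A u) \<otimes> ?R"
    using u(1) R(2) sW by (simp add: W_def mult_assoc del: nat_pow_Suc)
  then have WW: "star A W \<otimes> W = \<one>" using u R by (simp del: nat_pow_Suc)
  have "W \<ominus> w = star A (u \<ominus> p) \<otimes> ?R"
    using u pA R by (simp add: W_def w_def star_minus mult_minus_left del: nat_pow_Suc)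
  then have "cnorm A (W \<ominus> w) \<le> cnorm A (star A (u \<ominus> p)) * cnorm A ?R"
    using cnorm_mult[of "star A (u \<ominus> p)" ?R] u pA R(2) by (simp del: nat_pow_Suc)
  also have "\<dots> \<le> cnorm A (u \<ominus> p) * 1"
    using isometry_cnorm_le[OF R(2,1)] u pA by (intro mult_mono) (auto simp: cnorm_nonneg R(2) simp del: nat_pow_Suc)
  finally have nearW: "cnorm A (W \<ominus> w) < 1" using near by simp
  have "w \<in> homogeneous 0"
    using homogeneous_mult[OF homogeneous_star[OF p] T_pow_homogeneous[of "Suc m"]]
    by (simp add: w_def k_eq del: nat_pow_Suc)
  then obtain G where G: "finite G" "G \<subseteq> carrier A" "\<And>i. w [^] (i::nat) \<in> lin_span G"
    using finite_dimensional_homogeneous_0 by blast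
  have WW': "W \<otimes> star A W = \<one>"
    by (rule isometry_unitary_if_near_algebraic[OF W WW nearW w G])
  have "?R \<otimes> star A ?R = (u \<otimes> star A u) \<otimes> ?R \<otimes> star A ?R \<otimes> (u \<otimes> star A u)"
    using u R by (simp del: nat_pow_Suc)
  also have "\<dots> = u \<otimes> (W \<otimes> star A W) \<otimes> star A u"
    unfolding sW using u(1) R(2) by (simp add: W_def mult_assoc del: nat_pow_Suc)
  also have "\<dots> = \<one>" using WW' u by simp
  finally have RR: "?R \<otimes> star A ?R = \<one>" .
  define r where "r = T [^] m \<otimes> star A ?R"
  have r: "r \<in> carrier A" using R(2) by (simp add: r_def del: nat_pow_Suc)
  have Tr: "T \<otimes> r = \<one>"
    using RR R(2) nat_pow_Suc2[OF T_closed, of m] mult_assoc[of T "T [^] m" "star A ?R"]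
    by (simp add: r_def del: nat_pow_Suc)
  have "star A T = (star A T \<otimes> T) \<otimes> r"
    using Tr r T_isometry mult_assoc[of "star A T" T r] by simp
  then have "star A T = r" using T_isometry r by simp
  then show ?thesis using Tr by simp
qed

abbreviation pred :: "'v \<Rightarrow> 'v" where
  "pred v \<equiv> tail E (arc v)"

lemma pred_funpow_verts: "v \<in> verts E \<Longrightarrow> (pred ^^ j) v \<in> verts E"
  by (induction j) (auto simp: arc)

text \<open>Multiplication by \<open>T\<close> moves the vertex \<open>v\<close> to the tail of its chosen edge.\<close>

lemma P_mult_T_pow:
  assumes w: "w \<in> verts E" and "v \<in> verts E"
  shows "P w \<otimes> T [^] j \<otimes> P v = (if w = (pred ^^ j) v then T [^] j \<otimes> P v else \<zero>)"
  using assms(2)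
proof (induction j arbitrary: v)
  case 0
  then show ?case using w P_orth[of w v] by (cases "w = v") auto
next
  case (Suc j)
  let ?x = "pred v"
  have x: "?x \<in> verts E" "S (arc v) \<in> carrier A" using Suc.prems arc by auto
  have TP: "T [^] Suc j \<otimes> P v = T [^] j \<otimes> P ?x \<otimes> S (arc v)"
    using Suc.prems x by (simp add: mult_assoc T_mult_P P_tail_S arc)
  have "P w \<otimes> T [^] Suc j \<otimes> P v = P w \<otimes> (T [^] Suc j \<otimes> P v)"
    using Suc.prems w by (simp add: mult_assoc)
  also have "\<dots> = (P w \<otimes> T [^] j \<otimes> P ?x) \<otimes> S (arc v)"
    unfolding TP using x w by (simp add: mult_assoc)
  also have "\<dots> = (if w = (pred ^^ j) ?x then T [^] j \<otimes> P ?x else \<zero>) \<otimes> S (arc v)"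
    by (simp only: Suc.IH[OF x(1)])
  also have "(pred ^^ j) ?x = (pred ^^ Suc j) v"
    by (simp only: funpow_Suc_right comp_apply)
  also have "(if w = (pred ^^ Suc j) v then T [^] j \<otimes> P ?x else \<zero>) \<otimes> S (arc v)
      = (if w = (pred ^^ Suc j) v then T [^] Suc j \<otimes> P v else \<zero>)"
    unfolding TP using x by simp
  finally show ?case .
qed

lemma eq_if_eq_mult_P:
  assumes "x \<in> carrier A" "y \<in> carrier A" "\<And>v. v \<in> verts E \<Longrightarrow> x \<otimes> P v = y \<otimes> P v"
  shows "x = y"
proof -
  have P: "P \<in> verts E \<rightarrow> carrier A" by auto
  have "x \<otimes> \<one> = y \<otimes> \<one>"
    unfolding P_sum[symmetric] finsum_mult_right[OF finite_verts P assms(1)]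
      finsum_mult_right[OF finite_verts P assms(2)]
    using assms by (intro M.finsum_cong') auto
  then show ?thesis using assms by simp
qed

lemma ex_repeated_pred_funpow:
  obtains i m where "m > 0" "\<And>v. v \<in> verts E \<Longrightarrow> (pred ^^ (i + m)) v = (pred ^^ i) v"
proof -
  let ?g = "\<lambda>n. restrict (pred ^^ n) (verts E)"
  have "range ?g \<subseteq> verts E \<rightarrow>\<^sub>E verts E" using pred_funpow_verts by auto
  then have "finite (range ?g)"
    using finite_PiE[OF finite_verts, of "\<lambda>_. verts E"] finite_verts finite_subset by blast
  then have "\<not> inj ?g" using finite_imageD infinite_UNIV_nat by blast
  then obtain i j where ij: "i < j" "?g i = ?g j"
    unfolding inj_on_def by (metis linorder_neqE_nat)
  have "(pred ^^ (i + (j - i))) v = (pred ^^ i) v" if "v \<in> verts E" for v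
    using fun_cong[OF ij(2), of v] ij(1) that by simp
  then show thesis using that[of "j - i" i] ij(1) by simp
qed

text \<open>Once \<open>T T\<^sup>* = 1\<close>, an edge outside the choice satisfies \<open>S\<^sub>f\<^sup>* = S\<^sub>f\<^sup>* T T\<^sup>* = 0\<close>, so the algebra is
generated by \<open>T\<close> and the vertex projections. Conjugation by \<open>T\<close> acts on the projections through a
self-map of the finite vertex set; two of its iterates coincide, say \<open>i\<close> and \<open>i + m\<close>, and cancelling
the unitary \<open>T\<^sup>i\<close> shows that \<open>T\<^sup>m\<close> commutes with every vertex projection.\<close>

lemma T_pow_central_if_T_unitary:
  assumes TT: "T \<otimes> star A T = \<one>"
  obtains m :: nat where "m > 0" "\<And>x. x \<in> carrier A \<Longrightarrow> T [^] m \<otimes> x = x \<otimes> T [^] m"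
proof -
  obtain i m where m: "m > 0" "\<And>v. v \<in> verts E \<Longrightarrow> (pred ^^ (i + m)) v = (pred ^^ i) v"
    by (rule ex_repeated_pred_funpow) blast
  have iso: "star A (T [^] j) \<otimes> T [^] j = \<one>" for j :: nat
    by (rule isometry_nat_pow[OF T_closed T_isometry])
  have coiso: "T [^] j \<otimes> star A (T [^] j) = \<one>" for j :: nat
    using isometry_nat_pow[of "star A T" j] TT by (simp add: star_nat_pow)
  have conj: "star A (T [^] j) \<otimes> P w \<otimes> T [^] j \<otimes> P v = (if w = (pred ^^ j) v then P v else \<zero>)"
    if "w \<in> verts E" "v \<in> verts E" for w v and j :: nat
  proof -
    have "star A (T [^] j) \<otimes> P w \<otimes> T [^] j \<otimes> P v = star A (T [^] j) \<otimes> (P w \<otimes> T [^] j \<otimes> P v)"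
      using that by (simp add: mult_assoc)
    also have "\<dots> = (if w = (pred ^^ j) v then (star A (T [^] j) \<otimes> T [^] j) \<otimes> P v else \<zero>)"
      unfolding P_mult_T_pow[OF that] using that by (simp add: mult_assoc)
    finally show ?thesis using iso that by simp
  qed
  have TP: "T [^] m \<otimes> P w = P w \<otimes> T [^] m" if w: "w \<in> verts E" for w
  proof -
    have "star A (T [^] (i + m)) \<otimes> P w \<otimes> T [^] (i + m) = star A (T [^] i) \<otimes> P w \<otimes> T [^] i"
    proof (rule eq_if_eq_mult_P)
      fix v assume v: "v \<in> verts E"
      show "star A (T [^] (i + m)) \<otimes> P w \<otimes> T [^] (i + m) \<otimes> P v = star A (T [^] i) \<otimes> P w \<otimes> T [^] i \<otimes> P v"
        by (simp only: conj[OF w v] m(2)[OF v])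
    qed (use w in auto)
    moreover have "T [^] (i + m) = T [^] m \<otimes> T [^] i"
      by (simp add: nat_pow_mult add.commute)
    ultimately have "T [^] i \<otimes> (star A (T [^] i) \<otimes> P w \<otimes> T [^] i) \<otimes> star A (T [^] i)
        = T [^] i \<otimes> (star A (T [^] m \<otimes> T [^] i) \<otimes> P w \<otimes> (T [^] m \<otimes> T [^] i)) \<otimes> star A (T [^] i)"
      by simp
    also have "\<dots> = (T [^] i \<otimes> star A (T [^] i)) \<otimes> star A (T [^] m) \<otimes> P w \<otimes> T [^] m
        \<otimes> (T [^] i \<otimes> star A (T [^] i))"
      using w by (simp add: star_mult mult_assoc)
    also have "\<dots> = star A (T [^] m) \<otimes> P w \<otimes> T [^] m" using coiso w by simp
    also have "T [^] i \<otimes> (star A (T [^] i) \<otimes> P w \<otimes> T [^] i) \<otimes> star A (T [^] i)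
        = (T [^] i \<otimes> star A (T [^] i)) \<otimes> P w \<otimes> (T [^] i \<otimes> star A (T [^] i))"
      using w by (simp add: mult_assoc)
    finally have Pw: "P w = star A (T [^] m) \<otimes> P w \<otimes> T [^] m" using coiso w by simp
    have "T [^] m \<otimes> P w = (T [^] m \<otimes> star A (T [^] m)) \<otimes> (P w \<otimes> T [^] m)"
      by (subst Pw) (use w in \<open>simp add: mult_assoc\<close>)
    then show ?thesis using coiso w by simp
  qed
  have TS: "T [^] m \<otimes> S f = S f \<otimes> T [^] m" if f: "f \<in> arcs E" for f
  proof (cases "f \<in> arc ` verts E")
    case True
    then obtain v where v: "v \<in> verts E" "f = arc v" by blast
    have comm: "T [^] m \<otimes> T = T \<otimes> T [^] m" using nat_pow_Suc2[OF T_closed, of m] by simp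
    have "T [^] m \<otimes> (T \<otimes> P v) = T \<otimes> (T [^] m \<otimes> P v)"
      using comm v mult_assoc[of "T [^] m" T "P v"] mult_assoc[of T "T [^] m" "P v"] by simp
    also have "\<dots> = (T \<otimes> P v) \<otimes> T [^] m" using v by (simp add: TP mult_assoc)
    finally show ?thesis using T_mult_P v by simp
  next
    case False
    have "star A (S f) = (star A (S f) \<otimes> T) \<otimes> star A T"
      using f TT by (simp add: mult_assoc)
    also have "\<dots> = \<zero>" using star_S_mult_T[OF f] False by simp
    finally have "S f = \<zero>" using f star_star[of "S f"] by simp
    then show ?thesis by simp
  qed
  have star_comm: "star A (T [^] m) \<otimes> x = x \<otimes> star A (T [^] m)"
    if "x \<in> carrier A" "T [^] m \<otimes> x = x \<otimes> T [^] m" for x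
  proof -
    have "star A (T [^] m) \<otimes> x = star A (T [^] m) \<otimes> (x \<otimes> T [^] m) \<otimes> star A (T [^] m)"
      using that(1) coiso[of m] by (simp add: mult_assoc)
    also have "\<dots> = (star A (T [^] m) \<otimes> T [^] m) \<otimes> x \<otimes> star A (T [^] m)"
      unfolding that(2)[symmetric] using that(1) by (simp add: mult_assoc)
    finally show ?thesis using iso that(1) by simp
  qed
  have "{x \<in> carrier A. T [^] m \<otimes> x = x \<otimes> T [^] m \<and> star A (T [^] m) \<otimes> x = x \<otimes> star A (T [^] m)} = carrier A"
    by (rule generated[OF cstar_subalgebra_commutant]) (use TP TS star_comm in auto)
  then show thesis using that[OF m(1)] by blast
qed

text \<open>The central element \<open>T\<^sup>m\<close> lies in the relative commutant, so it is a scalar and fixed by the gauge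
action. But it has degree \<open>m > 0\<close>, so the gauge automorphism at a root \<open>t\<close> of \<open>t\<^sup>m = - 1\<close> negates it.\<close>

lemma trivial_if_T_unitary:
  assumes comm: "relative_commutant A (core E A P S) = {c \<odot> \<one> | c. True}"
    and TT: "T \<otimes> star A T = \<one>"
  shows "\<one> = \<zero>"
proof -
  obtain m :: nat where m: "m > 0" "\<And>x. x \<in> carrier A \<Longrightarrow> T [^] m \<otimes> x = x \<otimes> T [^] m"
    using T_pow_central_if_T_unitary[OF TT] by blast
  have "T [^] m \<in> relative_commutant A (core E A P S)"
    using m(2) by (auto simp: relative_commutant_def core_def)
  then obtain c where c: "T [^] m = c \<odot> \<one>" unfolding comm by blast
  define t where "t = cis (pi / m)"
  have t: "cmod t = 1" by (simp add: t_def)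
  have tm: "t ^ m = - 1" using m(1) by (simp add: t_def DeMoivre)
  have "T [^] m = gauge t (T [^] m)"
    using c gauge_smult[OF t, of \<one> c] gauge_one[OF t] by simp
  also have "\<dots> = (- 1) \<odot> T [^] m"
    using gauge_homogeneous[OF t T_pow_homogeneous[of m]] tm by simp
  finally have "T [^] m \<oplus> T [^] m = T [^] m \<oplus> (- 1) \<odot> T [^] m" by simp
  also have "\<dots> = (1 + - 1) \<odot> T [^] m"
    using smult_add_left[of "T [^] m" 1 "- 1"] by simp
  finally have "(1/2) \<odot> (T [^] m \<oplus> T [^] m) = \<zero>" by simp
  moreover have "(1/2) \<odot> (T [^] m \<oplus> T [^] m) = (1/2 + 1/2) \<odot> T [^] m"
    by (simp only: smult_add_left smult_add_right nat_pow_closed T_closed)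
  ultimately have "T [^] m = \<zero>" by simp
  then show ?thesis using isometry_nat_pow[OF T_closed T_isometry, of m] by simp
qed

end

section \<open>Unitaries normalising the core\<close>

context unital_graph_algebra
begin

text \<open>Since \<open>u x u\<^sup>*\<close> is gauge invariant for every \<open>x\<close> in the core, \<open>u\<^sup>* \<gamma>\<^sub>t(u)\<close> commutes with the core and
is a scalar: \<open>u\<close> is an eigenvector of all gauge automorphisms. It is then a norm limit of
homogeneous elements. Degrees other than 0 are impossible within distance 1 of \<open>u\<close>, the negative ones
by passing to \<open>u\<^sup>*\<close>, so \<open>u\<close> is a limit of gauge-invariant elements.\<close>

lemma unitary_in_core:
  assumes sources: "\<forall>v\<in>verts E. in_arcs E v \<noteq> {}"
    and comm: "relative_commutant A (core E A P S) = {c \<odot> \<one> | c. True}"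
    and u: "u \<in> carrier A" "star A u \<otimes> u = \<one>" "u \<otimes> star A u = \<one>"
    and norm: "\<forall>x\<in>core E A P S. u \<otimes> x \<otimes> star A u \<in> core E A P S"
  shows "u \<in> core E A P S"
proof (cases "\<one> = \<zero>")
  case True
  have "x = \<zero>" if "x \<in> carrier A" for x using unit_mult[OF that] that True by simp
  then have "gauge t u = u" if "cmod t = 1" for t
    using gauge_closed[OF that u(1)] u(1) by metis
  then show ?thesis using u by (simp add: core_iff)
next
  case False
  then have u0: "u \<noteq> \<zero>" using u by auto
  have su: "star A u \<in> carrier A" using u by simp
  have "\<exists>c. gauge t u = c \<odot> u" if t: "cmod t = 1" for t
  proof -
    note gu = gauge_closed[OF t u(1)]
    have gg: "star A (gauge t u) \<otimes> gauge t u = \<one>"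
      using gauge_mult[OF t su u(1)] gauge_star[OF t u(1)] u gauge_one[OF t] by simp
    have "(star A u \<otimes> gauge t u) \<otimes> x = x \<otimes> (star A u \<otimes> gauge t u)" if x: "x \<in> core E A P S" for x
    proof -
      have xA: "x \<in> carrier A" "gauge t x = x" using x t by (auto simp: core_iff)
      have "u \<otimes> x \<otimes> star A u = gauge t (u \<otimes> x \<otimes> star A u)"
        using norm x t by (auto simp: core_iff)
      also have "\<dots> = gauge t u \<otimes> x \<otimes> star A (gauge t u)"
        using u xA t by (simp add: gauge_mult gauge_star)
      finally have "star A u \<otimes> (u \<otimes> x \<otimes> star A u) \<otimes> gauge t u
          = star A u \<otimes> (gauge t u \<otimes> x \<otimes> star A (gauge t u)) \<otimes> gauge t u" by simp
      moreover have "star A u \<otimes> (u \<otimes> x \<otimes> star A u) \<otimes> gauge t u = (star A u \<otimes> u) \<otimes> x \<otimes> (star A u \<otimes> gauge t u)"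
        using u(1) xA gu by (simp add: mult_assoc)
      moreover have "star A u \<otimes> (gauge t u \<otimes> x \<otimes> star A (gauge t u)) \<otimes> gauge t u
          = (star A u \<otimes> gauge t u) \<otimes> x \<otimes> (star A (gauge t u) \<otimes> gauge t u)"
        using u(1) xA gu by (simp add: mult_assoc)
      ultimately show ?thesis using u gg gu xA by simp
    qed
    then have "star A u \<otimes> gauge t u \<in> relative_commutant A (core E A P S)"
      using u gu by (simp add: relative_commutant_def)
    then obtain c where c: "star A u \<otimes> gauge t u = c \<odot> \<one>" unfolding comm by blast
    have "gauge t u = (u \<otimes> star A u) \<otimes> gauge t u" using u gu by simp
    also have "\<dots> = u \<otimes> (c \<odot> \<one>)" using u(1) gu c by (simp add: mult_assoc)
    also have "\<dots> = c \<odot> u" using u by (simp add: smult_mult_right)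
    finally show ?thesis by blast
  qed
  then obtain c where c: "\<And>t. cmod t = 1 \<Longrightarrow> gauge t u = c t \<odot> u" by metis
  have "\<forall>v\<in>verts E. \<exists>a. a \<in> in_arcs E v" using sources by blast
  then obtain arc where arc: "\<And>v. v \<in> verts E \<Longrightarrow> arc v \<in> in_arcs E v" by metis
  interpret incoming_arcs A E P S arc
    by unfold_locales (use arc in auto)
  have no_positive: False
    if "w \<in> carrier A" "star A w \<otimes> w = \<one>" "w \<otimes> star A w = \<one>" "p \<in> homogeneous k" "k > 0"
      "cnorm A (w \<ominus> p) < 1" for w p k
    using trivial_if_T_unitary[OF comm T_unitary_if_unitary_near_positive_degree[OF that]] False by simp
  have degree_0: "k = 0" if p: "p \<in> homogeneous k" and near: "cnorm A (u \<ominus> p) < 1" for k p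
  proof (rule ccontr)
    assume "k \<noteq> 0"
    then consider "k > 0" | "- k > 0" by linarith
    then show False
    proof cases
      case 1 then show ?thesis using no_positive[OF u p _ near] by simp
    next
      case 2
      have "cnorm A (star A u \<ominus> star A p) < 1"
        using near u homogeneous_closed[OF p] by (simp add: star_minus[symmetric])
      then show ?thesis
        using no_positive[OF su _ _ homogeneous_star[OF p] 2] u by simp
    qed
  qed
  have "gauge t u = u" if t: "cmod t = 1" for t
  proof (rule eq_if_arbitrarily_close[where K=2])
    fix \<epsilon> :: real assume "\<epsilon> > 0"
    then have "min 1 \<epsilon> > 0" by simp
    obtain k p where p: "p \<in> homogeneous k" "cnorm A (u \<ominus> p) < min 1 \<epsilon>"
      by (rule gauge_eigenvector_near_homogeneous[OF u(1) u0 c \<open>min 1 \<epsilon> > 0\<close>])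
    have pA: "p \<in> carrier A" using homogeneous_closed[OF p(1)] .
    have "k = 0" using degree_0[OF p(1)] p(2) by simp
    then have "gauge t p = p" using gauge_homogeneous[OF t p(1)] pA by simp
    then have "cnorm A (gauge t u \<ominus> p) \<le> cnorm A (u \<ominus> p)"
      using gauge_contractive[OF t, of "u \<ominus> p"] gauge_minus[OF t u(1) pA] u pA by simp
    then show "cnorm A (gauge t u \<ominus> u) \<le> 2 * \<epsilon>"
      using cnorm_minus_triangle[of "gauge t u" p u] cnorm_minus_commute[of p u] p(2) pA u
        gauge_closed[OF t u(1)] by simp
  qed (use u t gauge_closed in auto)
  then show ?thesis using u by (simp add: core_iff)
qed

end

section \<open>Providing the unit\<close>

text \<open>The locales for monoids and rings take the unit from the record field \<^const>\<open>monoid.one\<close>. Storing the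
  sum of the vertex projections there leaves all C*-algebraic notions as they are.\<close>

lemma finsum_one_update [simp]: "finsum (A\<lparr>monoid.one := e\<rparr>) f I = finsum A f I"
  by (simp add: finsum_def)

lemma cdist_one_update [simp]: "cdist (A\<lparr>monoid.one := e\<rparr>) = cdist A"
  by (simp add: cdist_def fun_eq_iff a_minus_def a_inv_def)

lemma cstar_subalgebra_one_update [simp]:
  "cstar_subalgebra B (A\<lparr>monoid.one := e\<rparr>) \<longleftrightarrow> cstar_subalgebra B A"
  by (simp add: cstar_subalgebra_def cstar_topology_def)

lemma star_hom_one_update [simp]: "star_hom (A\<lparr>monoid.one := e\<rparr>) B = star_hom A B"
  "star_hom B (A\<lparr>monoid.one := e\<rparr>) = star_hom B A"
  by (simp_all add: star_hom_def)

lemma cuntz_krieger_family_one_update [simp]: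
  "cuntz_krieger_family E (A\<lparr>monoid.one := e\<rparr>) P S \<longleftrightarrow> cuntz_krieger_family E A P S"
  by (simp add: cuntz_krieger_family_def projection_def partial_isometry_def projection_le_def)

lemma core_one_update [simp]: "core E (A\<lparr>monoid.one := e\<rparr>) P S = core E A P S"
  by (simp add: core_def gauge_action_def star_aut_def)

lemma (in cstar_algebra) cstar_algebra_one_update: "cstar_algebra (A\<lparr>monoid.one := e\<rparr>)"
proof (intro cstar_algebra.intro cstar_algebra_axioms.intro)
  show "module (ring_of_type_algebra :: complex ring) (A\<lparr>monoid.one := e\<rparr>)"
  proof (rule moduleI)
    show "cring (ring_of_type_algebra :: complex ring)" by (rule R.is_cring)
    show "abelian_group (A\<lparr>monoid.one := e\<rparr>)"
    proof (rule abelian_groupI)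
      fix x assume "x \<in> carrier (A\<lparr>monoid.one := e\<rparr>)"
      then show "\<exists>y\<in>carrier (A\<lparr>monoid.one := e\<rparr>). y \<oplus>\<^bsub>A\<lparr>monoid.one := e\<rparr>\<^esub> x = \<zero>\<^bsub>A\<lparr>monoid.one := e\<rparr>\<^esub>"
        by (auto intro!: bexI[of _ "\<ominus> x"] simp: M.l_neg)
    qed (auto simp: M.add.m_ac)
  qed (auto simp: ring_of_type_algebra_def smult_add_left smult_add_right smult_smult)
qed (use complete in \<open>auto simp: mult_assoc mult_add_left mult_add_right smult_mult_left
    smult_mult_right star_add star_smult star_mult cnorm_nonneg cnorm_eq_0 cnorm_triangle cnorm_smult
    cnorm_mult cstar_identity\<close>)

lemma graph_cstar_algebra_one_update:
  assumes "graph_cstar_algebra E A P S"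
  shows "graph_cstar_algebra E (A\<lparr>monoid.one := e\<rparr>) P S"
proof -
  interpret cstar_algebra A using assms by (simp add: graph_cstar_algebra_def)
  show ?thesis
    using assms cstar_algebra_one_update by (simp add: graph_cstar_algebra_def)
qed

theorem theorem4p2:
  fixes E :: "('v, 'e) pre_digraph"
    and A :: "'a cstar" and P :: "'v \<Rightarrow> 'a" and S :: "'e \<Rightarrow> 'a" and u :: 'a
  assumes "countable_digraph E"
    and "graph_cstar_algebra E A P S"
    and "finite (verts E)"
    and "\<forall>v\<in>verts E. in_arcs E v \<noteq> {}"
    and "relative_commutant A (core E A P S) = {c \<odot>\<^bsub>A\<^esub> cstar_unit A | c. True}"
    and "u \<in> unitary_group A"
    and "\<forall>x\<in>core E A P S. u \<otimes>\<^bsub>A\<^esub> x \<otimes>\<^bsub>A\<^esub> star A u \<in> core E A P S"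
  shows "u \<in> unitary_group (A\<lparr>carrier := core E A P S\<rparr>)"
proof -
  have wf: "wf_digraph E" using assms(1) by (simp add: countable_digraph_def)
  have A: "cstar_algebra A" using assms(2) by (simp add: graph_cstar_algebra_def)
  interpret A: cstar_algebra A by (rule A)
  let ?e = "\<Oplus>\<^bsub>A\<^esub>v\<in>verts E. P v"
  note e = A.cuntz_krieger_unit[OF wf assms(2,3)]
  let ?A = "A\<lparr>monoid.one := ?e\<rparr>"
  interpret unital_graph_algebra ?A E P S
  proof (intro unital_graph_algebra.intro unital_cstar_algebra.intro unital_cstar_algebra_axioms.intro
      unital_graph_algebra_axioms.intro)
    show "cstar_algebra ?A" by (rule A.cstar_algebra_one_update)
    show "wf_digraph E" by (rule wf)
    show "graph_cstar_algebra E ?A P S" by (rule graph_cstar_algebra_one_update[OF assms(2)])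
    show "finite (verts E)" by (rule assms(3))
    show "(\<Oplus>\<^bsub>?A\<^esub>v\<in>verts E. P v) = \<one>\<^bsub>?A\<^esub>" by simp
    show "\<one>\<^bsub>?A\<^esub> \<in> carrier ?A" using e(1)[OF A.M.zero_closed] by simp
    show "\<one>\<^bsub>?A\<^esub> \<otimes>\<^bsub>?A\<^esub> x = x" "x \<otimes>\<^bsub>?A\<^esub> \<one>\<^bsub>?A\<^esub> = x" if "x \<in> carrier ?A" for x
      using e(2,3)[of x] that by simp_all
  qed
  have unit: "cstar_unit A = ?e" using cstar_unit_eq by (simp add: cstar_unit_def)
  have core: "core E ?A P S = core E A P S" by simp
  have u: "u \<in> carrier A" "star A u \<otimes>\<^bsub>A\<^esub> u = ?e" "u \<otimes>\<^bsub>A\<^esub> star A u = ?e"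
    using assms(6) by (auto simp: unitary_group_def unit)
  have "u \<in> core E ?A P S"
    using assms(4,5,7) u by (intro unitary_in_core) (simp_all add: core relative_commutant_def unit)
  then have uc: "u \<in> core E A P S" by (simp add: core)
  have "?e \<in> core E ?A P S" using core_iff[of ?e] unit_closed gauge_one by simp
  then have ec: "?e \<in> core E A P S" by (simp add: core)
  have "cstar_unit (A\<lparr>carrier := core E A P S\<rparr>) = ?e"
    unfolding cstar_unit_def
  proof (rule the_equality)
    have "x \<in> carrier A" if "x \<in> core E A P S" for x using that by (simp add: core_def)
    then show "?e \<in> carrier (A\<lparr>carrier := core E A P S\<rparr>) \<and>
        (\<forall>x\<in>carrier (A\<lparr>carrier := core E A P S\<rparr>).
          ?e \<otimes>\<^bsub>A\<lparr>carrier := core E A P S\<rparr>\<^esub> x = x \<and> x \<otimes>\<^bsub>A\<lparr>carrier := core E A P S\<rparr>\<^esub> ?e = x)"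
      using ec e by simp
  next
    fix f
    assume f: "f \<in> carrier (A\<lparr>carrier := core E A P S\<rparr>) \<and>
        (\<forall>x\<in>carrier (A\<lparr>carrier := core E A P S\<rparr>).
          f \<otimes>\<^bsub>A\<lparr>carrier := core E A P S\<rparr>\<^esub> x = x \<and> x \<otimes>\<^bsub>A\<lparr>carrier := core E A P S\<rparr>\<^esub> f = x)"
    then have "f \<otimes>\<^bsub>A\<^esub> ?e = ?e" using ec by simp
    moreover have "f \<otimes>\<^bsub>A\<^esub> ?e = f" using f e(3)[of f] by (simp add: core_def)
    ultimately show "f = ?e" by simp
  qed
  then show ?thesis using u uc by (simp add: unitary_group_def)
qed

end
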